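(* Let $h,n$ be integers with $3\le h\le n-1$. The graph $K^{h}_{n}$ is determined by its $D$-spectrum: every connected graph whose distance matrix has the same spectrum as $D(K^{h}_{n})$ is isomorphic to $K^{h}_{n}$.
   Context: All graphs are simple, undirected and connected. For a connected graph $G$ with vertices $v_1,\dots,v_n$, the distance matrix is $D(G)=(d_{ij})$, where $d_{ij}$ is the distance between $v_i$ and $v_j$; its eigenvalues form the distance spectrum ($D$-spectrum) of $G$. Two graphs are $D$-cospectral if they have the same distance spectrum, and $G$ is determined by its $D$-spectrum if every graph $D$-cospectral to $G$ is isomorphic to $G$. $K^{h}_{n}$ denotes the graph on $n$ vertices obtained from the complete graph $K_h$ by attaching $n-h$ pendant edges to one vertex of $K_h$. *)

theory Defs
  imports "Jordan_Normal_Form.Char_Poly" "HOL-Computational_Algebra.Polynomial"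
begin

definition simple_graph :: "nat \<Rightarrow> (nat \<Rightarrow> nat \<Rightarrow> bool) \<Rightarrow> bool" where
  "simple_graph n E \<longleftrightarrow> (\<forall>i j. E i j \<longrightarrow> i < n \<and> j < n \<and> i \<noteq> j \<and> E j i)"

fun walk :: "(nat \<Rightarrow> nat \<Rightarrow> bool) \<Rightarrow> nat \<Rightarrow> nat \<Rightarrow> nat \<Rightarrow> bool" where
  "walk E 0 i j = (i = j)"
| "walk E (Suc k) i j = (\<exists>l. E i l \<and> walk E k l j)"

definition connected_graph :: "nat \<Rightarrow> (nat \<Rightarrow> nat \<Rightarrow> bool) \<Rightarrow> bool" where
  "connected_graph n E \<longleftrightarrow> 0 < n \<and> (\<forall>i<n. \<forall>j<n. \<exists>k. walk E k i j)"

definition gdist :: "(nat \<Rightarrow> nat \<Rightarrow> bool) \<Rightarrow> nat \<Rightarrow> nat \<Rightarrow> nat" where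
  "gdist E i j = (LEAST k. walk E k i j)"

definition dist_matrix :: "nat \<Rightarrow> (nat \<Rightarrow> nat \<Rightarrow> bool) \<Rightarrow> real mat" where
  "dist_matrix n E = mat n n (\<lambda>(i, j). real (gdist E i j))"

definition D_spectrum :: "nat \<Rightarrow> (nat \<Rightarrow> nat \<Rightarrow> bool) \<Rightarrow> complex multiset" where
  "D_spectrum n E = proots (char_poly (map_mat complex_of_real (dist_matrix n E)))"

definition graph_iso :: "nat \<Rightarrow> (nat \<Rightarrow> nat \<Rightarrow> bool) \<Rightarrow> nat \<Rightarrow> (nat \<Rightarrow> nat \<Rightarrow> bool) \<Rightarrow> bool" where
  "graph_iso m F n E \<longleftrightarrow>
     (\<exists>f. bij_betw f {..<m} {..<n} \<and> (\<forall>i<m. \<forall>j<m. F i j \<longleftrightarrow> E (f i) (f j)))"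

text \<open>K^h_n: clique on {0..<h}, with pendant vertices h..n-1 attached to vertex 0.\<close>
definition Khn :: "nat \<Rightarrow> nat \<Rightarrow> nat \<Rightarrow> nat \<Rightarrow> bool" where
  "Khn h n i j \<longleftrightarrow> i < n \<and> j < n \<and> i \<noteq> j \<and>
     ((i < h \<and> j < h) \<or> (i = 0 \<and> h \<le> j) \<or> (j = 0 \<and> h \<le> i))"

end

(*
  The spectrum of D(K^h_n) consists of -1 and -2 with multiplicities h-2 and n-h-1 and of three further
  eigenvalues l1 > -1/2 > l2 > -1 and l3 < -2. Hence for a cospectral graph F the form of D + 2I is
  nonnegative on a hyperplane, that of D + I/2 is nonpositive on a hyperplane and that of D + I is
  nonpositive on a subspace of codimension 2; every metric configuration of at most six vertices that
  carries a pair (or triple) of orthogonal vectors of the wrong sign is therefore forbidden in F.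
  If F had diameter at least 3, the forbidden configurations would make it two cliques joined by an
  edge, whose D + 2I is nonsingular. This contradicts the eigenvalue -2, which occurs since with at most
  three pendant vertices l2 would lie below the second eigenvalue of D(P4), already excluding distance 3.
  So F has diameter at most 2 and no induced P4 or C4. It then has a dominating vertex, and the remaining
  non-dominating vertices form a clique and, not adjacent to it, either a clique or an independent set.
  Comparing the characteristic polynomials of these three-cell graphs with that of K^h_n leaves K^h_n.
*)
theory Submission
  imports Defs
begin

section \<open>Diagonalization of real symmetric matrices\<close>

text \<open>The exclusions are Cauchy interlacing in certificate form. No eigenvalue of a small
  matrix is computed: a few integer vectors, mutually orthogonal for the form of D - tI and all of
  the same strict sign, span a space on which that form is definite, and its dimension exceeds what
  the spectrum allows. The matrices restricted in this way are principal submatrices of D(F), not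
  distance matrices of induced subgraphs, so shortest paths may leave the chosen vertices. The
  shifts must serve all h and n at once. The values -1 and -2 are the eigenvalues coming from
  adjacent and nonadjacent twins; -1/2 is the root of the factor 2z + 1, which divides every term of
  the cubic that contains the number of pendant vertices, so the sign there does not depend on that
  number. One determinant formula for matrices that are constant on cells yields both the spectrum
  of K^h_n and that of the final candidates. It divides by z + 1 and z + e, so characteristic
  polynomials are compared away from -1 and -2.\<close>

lemma householder_reflection:
  fixes v :: "real vec"
  assumes v: "v \<in> carrier_vec n" and unit: "(\<Sum>i<n. (v $ i)\<^sup>2) = 1" and n: "0 < n"
  obtains W where "W \<in> carrier_mat n n" "transpose_mat W = W" "W * W = 1\<^sub>m n" "col W 0 = v"
proof (cases "v = unit_vec n 0")
  case True
  show ?thesis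
    by (rule that[of "1\<^sub>m n"]) (use n True in auto)
next
  case False
  have split: "(\<Sum>i<n. (v $ i)\<^sup>2) = (v $ 0)\<^sup>2 + (\<Sum>i\<in>{..<n} - {0}. (v $ i)\<^sup>2)"
    using n by (subst sum.remove[of _ 0]) auto
  have v0: "v $ 0 \<noteq> 1"
  proof
    assume 1: "v $ 0 = 1"
    with split unit have "(\<Sum>i\<in>{..<n} - {0}. (v $ i)\<^sup>2) = 0" by simp
    then have "\<forall>i\<in>{..<n} - {0}. (v $ i)\<^sup>2 = 0"
      by (subst (asm) sum_nonneg_eq_0_iff) auto
    then have "v = unit_vec n 0" using 1 v n by (intro eq_vecI) auto
    with False show False by simp
  qed
  \<comment> \<open>\<open>W\<close> is the reflection I - c u u^T along u = v - e_0, which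
    exchanges v and e_0. Since |u|^2 = 2 - 2 v_0, the usual factor 2 / |u|^2 is \<open>c\<close>.
    The case v = e_0, where u vanishes, was split off above.\<close>
  define c where "c = 1 / (1 - v $ 0)"
  define u where "u i = v $ i - (if i = 0 then 1 else 0)" for i :: nat
  have "(\<Sum>i<n. (u i)\<^sup>2) = (u 0)\<^sup>2 + (\<Sum>i\<in>{..<n} - {0}. (u i)\<^sup>2)"
    using n by (subst sum.remove[of _ 0]) auto
  also have "(\<Sum>i\<in>{..<n} - {0}. (u i)\<^sup>2) = 1 - (v $ 0)\<^sup>2"
    using split unit by (simp add: u_def)
  finally have u2: "c * (\<Sum>i<n. u i * u i) = 2"
    using v0 by (simp add: u_def c_def power2_eq_square field_simps)
  define W where "W = mat n n (\<lambda>(i,j). (if i = j then 1 else 0) - c * u i * u j)"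
  have W: "W \<in> carrier_mat n n" by (simp add: W_def)
  show ?thesis
  proof (rule that[OF W])
    show "transpose_mat W = W" by (rule eq_matI) (auto simp: W_def)
    show "W * W = 1\<^sub>m n"
    proof (rule eq_matI)
      fix i j assume ij: "i < dim_row (1\<^sub>m n :: real mat)" "j < dim_col (1\<^sub>m n :: real mat)"
      have "(W * W) $$ (i,j) = (\<Sum>k<n. ((if i = k then 1 else 0) - c * u i * u k) *
          ((if k = j then 1 else 0) - c * u k * u j))"
        using ij by (simp add: W_def scalar_prod_def atLeast0LessThan)
      also have "\<dots> = (\<Sum>k<n. (if i = k then (if k = j then 1 else 0) - c * u k * u j else 0)
           - (if k = j then c * u i * u k else 0) + c * u i * u j * (c * (u k * u k)))"
        by (intro sum.cong) (auto simp: algebra_simps)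
      also have "\<dots> = (if i = j then 1 else 0) - 2 * (c * u i * u j) + c * u i * u j * (c * (\<Sum>k<n. u k * u k))"
        using ij by (simp add: sum.distrib sum_subtractf sum_distrib_left)
      finally show "(W * W) $$ (i,j) = 1\<^sub>m n $$ (i,j)" using u2 ij by simp
    qed (auto simp: W_def)
    have "c * u 0 = -1" using v0 by (simp add: c_def u_def field_simps)
    then have "c * u i * u 0 = - u i" for i
      by (metis mult.commute mult.left_commute mult_minus1)
    then show "col W 0 = v" using v n by (intro eq_vecI) (auto simp: W_def u_def)
  qed
qed

text \<open>Deflation: conjugating with a reflection whose first column is a unit eigenvector for
  the first root clears the first column and, by symmetry, the first row; the remaining block has
  the remaining roots. Following the list \<open>es\<close> keeps its order on the diagonal, so that
  eigenvalues can later be addressed by index.\<close>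

lemma real_symmetric_diagonalization:
  fixes A :: "real mat"
  assumes "A \<in> carrier_mat n n" and "transpose_mat A = A"
    and "char_poly A = (\<Prod>e\<leftarrow>es. [:- e, 1:])"
  shows "\<exists>P\<in>carrier_mat n n. transpose_mat P * P = 1\<^sub>m n \<and>
    transpose_mat P * A * P = mat_diag n (\<lambda>i. es ! i)"
  using assms
proof (induction es arbitrary: n A)
  case Nil
  have "n = 0" using Nil degree_monic_char_poly[OF Nil(1)] by simp
  then show ?case using Nil by (intro bexI[of _ "1\<^sub>m n"]) (auto intro!: eq_matI simp: mat_diag_def)
next
  case (Cons e es n A)
  note A = Cons.prems(1) and sym = Cons.prems(2) and cp = Cons.prems(3)
  have "eigenvalue A e" unfolding eigenvalue_root_char_poly[OF A] cp by simp
  then obtain w where w: "w \<in> carrier_vec n" "w \<noteq> 0\<^sub>v n" "A *\<^sub>v w = e \<cdot>\<^sub>v w"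
    using A unfolding eigenvalue_def eigenvector_def by auto
  obtain m where n: "n = Suc m" using w by (cases n) (auto intro!: eq_vecI)
  define s where "s = sqrt (\<Sum>i<n. (w $ i)\<^sup>2)"
  have "\<exists>i<n. w $ i \<noteq> 0" using w by (metis carrier_vecD eq_vecI index_zero_vec(1) index_zero_vec(2))
  then have "0 < (\<Sum>i<n. (w $ i)\<^sup>2)" by (auto intro: sum_pos2)
  then have s: "s \<noteq> 0" "s\<^sup>2 = (\<Sum>i<n. (w $ i)\<^sup>2)" by (auto simp: s_def)
  define v where "v = (1/s) \<cdot>\<^sub>v w"
  have v: "v \<in> carrier_vec n" "A *\<^sub>v v = e \<cdot>\<^sub>v v"
    using w A by (auto simp: v_def mult_mat_vec[of _ n n] smult_smult_assoc mult.commute[of e])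
  have "(\<Sum>i<n. (v $ i)\<^sup>2) = (\<Sum>i<n. (w $ i)\<^sup>2) / s\<^sup>2"
    using w by (simp add: v_def power_divide sum_divide_distrib)
  then have "(\<Sum>i<n. (v $ i)\<^sup>2) = 1" using s(1) unfolding s(2)[symmetric] by simp
  then obtain W where W: "W \<in> carrier_mat n n" "transpose_mat W = W" "W * W = 1\<^sub>m n" "col W 0 = v"
    using householder_reflection v n by blast
  define A' where "A' = W * A * W"
  have A': "A' \<in> carrier_mat n n" using A W by (simp add: A'_def)
  have symA': "transpose_mat A' = A'"
    using A W sym by (simp add: A'_def transpose_mult[of _ n n _ n] assoc_mult_mat[of _ n n _ n _ n])
  have "col A' 0 = (W * A) *\<^sub>v col W 0"
    unfolding A'_def using W A n by (intro col_mult2[of _ n n _ n]) auto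
  also have "\<dots> = W *\<^sub>v (A *\<^sub>v v)" using W A v by simp
  also have "\<dots> = e \<cdot>\<^sub>v (W *\<^sub>v col W 0)" using W v by (simp add: mult_mat_vec)
  also have "W *\<^sub>v col W 0 = col (W * W) 0" using W n by (subst col_mult2[of _ n n _ n]) auto
  also have "e \<cdot>\<^sub>v \<dots> = e \<cdot>\<^sub>v unit_vec n 0" using W n by simp
  finally have col0_eq: "col A' 0 = e \<cdot>\<^sub>v unit_vec n 0" .
  have col0: "A' $$ (i, 0) = (if i = 0 then e else 0)" if "i < n" for i
  proof -
    have "A' $$ (i, 0) = col A' 0 $ i" using that A' n by simp
    then show ?thesis using that n by (simp add: col0_eq)
  qed
  have row0: "A' $$ (0, i) = (if i = 0 then e else 0)" if "i < n" for i
  proof -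
    have "transpose_mat A' $$ (0, i) = A' $$ (i, 0)" using that A' n by simp
    then show ?thesis using col0[OF that] by (simp add: symA')
  qed
  define A3 where "A3 = mat m m (\<lambda>(i,j). A' $$ (Suc i, Suc j))"
  let ?E = "mat 1 1 (\<lambda>_. e)"
  have A3: "A3 \<in> carrier_mat m m" by (simp add: A3_def)
  have A'_block: "A' = four_block_mat ?E (0\<^sub>m 1 m) (0\<^sub>m m 1) A3"
    by (rule eq_matI) (use A' n col0 row0 in \<open>auto simp: A3_def four_block_mat_def Let_def\<close>)
  have symA3: "transpose_mat A3 = A3"
  proof (rule eq_matI)
    fix i j assume "i < dim_row A3" "j < dim_col A3"
    then have ij: "Suc i < n" "Suc j < n" by (auto simp: A3_def n)
    have "A' $$ (Suc j, Suc i) = transpose_mat A' $$ (Suc i, Suc j)" using ij A' by simp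
    then show "transpose_mat A3 $$ (i, j) = A3 $$ (i, j)" using ij by (simp add: A3_def symA' n)
  qed (auto simp: A3_def)
  have "W * A' * W = (W * W) * A * (W * W)"
    unfolding A'_def using W(1) A by (simp add: assoc_mult_mat[of _ n n _ n _ n])
  then have "A = W * A' * W" using A W by simp
  then have "similar_mat A A'"
    using A W A' by (intro similar_matI[of _ _ W W n]) auto
  then have "char_poly A = char_poly A'" by (rule char_poly_similar)
  also have "\<dots> = char_poly ?E * char_poly A3"
    unfolding A'_block by (rule char_poly_four_block_zeros_col[of _ _ m]) (auto simp: A3_def)
  also have "char_poly ?E = [:- e, 1:]"
    by (simp add: char_poly_defs det_single)
  finally have "[:- e, 1:] * char_poly A3 = [:- e, 1:] * (\<Prod>e\<leftarrow>es. [:- e, 1:])" using cp by simp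
  then have "char_poly A3 = (\<Prod>e\<leftarrow>es. [:- e, 1:])"
    by (metis mult_left_cancel one_neq_zero pCons_eq_0_iff)
  from Cons.IH[OF A3 symA3 this] obtain P3 where P3: "P3 \<in> carrier_mat m m"
    "transpose_mat P3 * P3 = 1\<^sub>m m" "transpose_mat P3 * A3 * P3 = mat_diag m (\<lambda>i. es ! i)" by auto
  define B where "B = four_block_mat (1\<^sub>m 1) (0\<^sub>m 1 m) (0\<^sub>m m 1) P3"
  have B: "B \<in> carrier_mat n n" using P3 unfolding B_def n
    by (metis four_block_carrier_mat one_carrier_mat plus_1_eq_Suc)
  have Bt: "transpose_mat B = four_block_mat (1\<^sub>m 1) (0\<^sub>m 1 m) (0\<^sub>m m 1) (transpose_mat P3)"
    unfolding B_def using P3 by (subst transpose_four_block_mat[of _ 1 1 _ m _ m]) auto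
  have BtB: "transpose_mat B * B = 1\<^sub>m n"
    unfolding Bt unfolding B_def using P3
    by (subst mult_four_block_mat[of _ 1 1 _ m _ m _ _ 1 _ m]) (auto simp: n)
  have "transpose_mat B * A' = four_block_mat ?E (0\<^sub>m 1 m) (0\<^sub>m m 1) (transpose_mat P3 * A3)"
    unfolding Bt A'_block using P3 A3
    by (subst mult_four_block_mat[of _ 1 1 _ m _ m _ _ 1 _ m]) auto
  then have "transpose_mat B * A' * B = four_block_mat ?E (0\<^sub>m 1 m) (0\<^sub>m m 1) (transpose_mat P3 * A3 * P3)"
    unfolding B_def using P3 A3
    by (simp, subst mult_four_block_mat[of _ 1 1 _ m _ m _ _ 1 _ m]) auto
  also have "\<dots> = mat_diag n (\<lambda>i. (e # es) ! i)"
    unfolding P3 by (rule eq_matI) (auto simp: n four_block_mat_def Let_def mat_diag_def nth_Cons')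
  finally have BAB: "transpose_mat B * A' * B = mat_diag n (\<lambda>i. (e # es) ! i)" .
  have Wt: "transpose_mat (W * B) = transpose_mat B * W"
    using W B by (simp add: transpose_mult[of _ n n _ n])
  have "transpose_mat (W * B) * (W * B) = transpose_mat B * (W * W) * B"
    unfolding Wt using W(1) B by (simp add: assoc_mult_mat[of _ n n _ n _ n])
  then have "transpose_mat (W * B) * (W * B) = 1\<^sub>m n" using B BtB W by simp
  moreover have "transpose_mat (W * B) * A * (W * B) = transpose_mat B * A' * B"
    unfolding Wt A'_def using W(1) B A by (simp add: assoc_mult_mat[of _ n n _ n _ n])
  ultimately show ?case using W B BAB by (intro bexI[of _ "W * B"]) auto
qed

section \<open>Characteristic polynomials of matrices that are constant on cells\<close>

text \<open>Both sides are determinants of products of the block matrices \<open>((1, X), (Y, 1))\<close> and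
  \<open>((1, - X), (0, 1))\<close>, taken in the two orders.\<close>

lemma det_one_minus_mult_swap:
  fixes X Y :: "'a :: idom mat"
  assumes X: "X \<in> carrier_mat n m" and Y: "Y \<in> carrier_mat m n"
  shows "det (1\<^sub>m n - X * Y) = det (1\<^sub>m m - Y * X)"
proof -
  let ?M = "four_block_mat (1\<^sub>m n) X Y (1\<^sub>m m)"
  let ?L = "four_block_mat (1\<^sub>m n) (- X) (0\<^sub>m m n) (1\<^sub>m m)"
  have XY: "X * Y \<in> carrier_mat n n" and YX: "Y * X \<in> carrier_mat m m" using X Y by auto
  have M: "?M \<in> carrier_mat (n + m) (n + m)" by (rule four_block_carrier_mat) auto
  have L: "?L \<in> carrier_mat (n + m) (n + m)" by (rule four_block_carrier_mat) auto
  have "?L * ?M = four_block_mat (1\<^sub>m n - X * Y) (0\<^sub>m n m) Y (1\<^sub>m m)"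
  proof -
    have "1\<^sub>m n * 1\<^sub>m n + - X * Y = 1\<^sub>m n - X * Y"
      using X Y XY by (intro eq_matI) auto
    moreover have "1\<^sub>m n * X + - X * 1\<^sub>m m = 0\<^sub>m n m"
      using X by (intro eq_matI) auto
    ultimately show ?thesis using X Y
      by (subst mult_four_block_mat[of _ n n _ m _ m _ _ n _ m]) auto
  qed
  moreover have "det (four_block_mat (1\<^sub>m n - X * Y) (0\<^sub>m n m) Y (1\<^sub>m m)) = det (1\<^sub>m n - X * Y)"
    using minus_carrier_mat[OF XY] Y by (subst det_four_block_mat_upper_right_zero[of _ n _ m]) auto
  ultimately have 1: "det (?L * ?M) = det (1\<^sub>m n - X * Y)" by metis
  have "?M * ?L = four_block_mat (1\<^sub>m n) (0\<^sub>m n m) Y (1\<^sub>m m - Y * X)"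
  proof -
    have "Y * - X + 1\<^sub>m m * 1\<^sub>m m = 1\<^sub>m m - Y * X"
      using X Y YX by (intro eq_matI) auto
    moreover have "1\<^sub>m n * - X + X * 1\<^sub>m m = 0\<^sub>m n m"
      using X by (intro eq_matI) auto
    ultimately show ?thesis using X Y
      by (subst mult_four_block_mat[of _ n n _ m _ m _ _ n _ m]) auto
  qed
  moreover have "det (four_block_mat (1\<^sub>m n) (0\<^sub>m n m) Y (1\<^sub>m m - Y * X)) = det (1\<^sub>m m - Y * X)"
    using minus_carrier_mat[OF YX] Y by (subst det_four_block_mat_upper_right_zero[of _ n _ m]) auto
  ultimately have 2: "det (?M * ?L) = det (1\<^sub>m m - Y * X)" by metis
  show ?thesis using 1 2 det_mult[OF L M] det_mult[OF M L] by (simp add: mult.commute)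
qed

lemma poly_char_poly:
  fixes A :: "'a :: field mat"
  assumes "A \<in> carrier_mat n n"
  shows "poly (char_poly A) z = det (z \<cdot>\<^sub>m 1\<^sub>m n - A)"
proof -
  have "- char_matrix A z = z \<cdot>\<^sub>m 1\<^sub>m n - A"
    using assms by (intro eq_matI) (auto simp: char_matrix_def)
  with char_poly_matrix[OF assms, of z] show ?thesis by simp
qed

text \<open>With \<open>B\<close> the diagonal matrix of the values z + w (c x) (c x), one has zI -
  A = B (1 - X Y), where \<open>Y\<close> holds the indicators of the cells. Swapping the two
  factors inside the determinant shrinks it from size n to the number m of cells.\<close>

lemma poly_char_poly_cells:
  fixes w :: "nat \<Rightarrow> nat \<Rightarrow> real" and c :: "nat \<Rightarrow> nat"
  assumes c: "\<And>x. x < n \<Longrightarrow> c x < m" and z: "\<And>k. k < m \<Longrightarrow> z + w k k \<noteq> 0"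
    and A: "A = mat n n (\<lambda>(x,y). if x = y then 0 else w (c x) (c y))"
  shows "poly (char_poly A) z = (\<Prod>x<n. z + w (c x) (c x)) *
    det (mat m m (\<lambda>(k,l). (if k = l then 1 else 0) - real (card {x. x < n \<and> c x = k}) * w k l / (z + w k k)))"
proof -
  define X where "X = mat n m (\<lambda>(x,k). w (c x) k / (z + w (c x) (c x)))"
  define Y :: "real mat" where "Y = mat m n (\<lambda>(k,x). if c x = k then 1 else 0)"
  define B where "B = mat n n (\<lambda>(x,y). if x = y then z + w (c x) (c x) else 0)"
  have X: "X \<in> carrier_mat n m" and Y: "Y \<in> carrier_mat m n" and B: "B \<in> carrier_mat n n"
    by (auto simp: X_def Y_def B_def)
  have XY: "(X * Y) $$ (x,y) = w (c x) (c y) / (z + w (c x) (c x))" if "x < n" "y < n" for x y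
  proof -
    have "(X * Y) $$ (x,y) = (\<Sum>k<m. w (c x) k / (z + w (c x) (c x)) * (if c y = k then 1 else 0))"
      using that by (simp add: X_def Y_def scalar_prod_def atLeast0LessThan)
    also have "\<dots> = (\<Sum>k<m. if c y = k then w (c x) k / (z + w (c x) (c x)) else 0)"
      by (intro sum.cong) auto
    finally show ?thesis using c[OF that(2)] by simp
  qed
  have YX: "(Y * X) $$ (k,l) = real (card {x. x < n \<and> c x = k}) * w k l / (z + w k k)"
    if "k < m" "l < m" for k l
  proof -
    have "(Y * X) $$ (k,l) = (\<Sum>x<n. (if c x = k then 1 else 0) * (w (c x) l / (z + w (c x) (c x))))"
      using that by (simp add: X_def Y_def scalar_prod_def atLeast0LessThan)
    also have "\<dots> = (\<Sum>x<n. if c x = k then w k l / (z + w k k) else 0)"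
      by (intro sum.cong) auto
    also have "\<dots> = (\<Sum>x\<in>{x. x < n \<and> c x = k}. w k l / (z + w k k))"
      by (simp add: sum.If_cases Int_def)
    finally show ?thesis by simp
  qed
  have "z \<cdot>\<^sub>m 1\<^sub>m n - A = B * (1\<^sub>m n - X * Y)"
  proof (rule eq_matI)
    fix x y assume "x < dim_row (B * (1\<^sub>m n - X * Y))" "y < dim_col (B * (1\<^sub>m n - X * Y))"
    then have xy: "x < n" "y < n" using B Y by auto
    have "(B * (1\<^sub>m n - X * Y)) $$ (x,y) =
        (\<Sum>k<n. (if x = k then z + w (c x) (c x) else 0) * ((1\<^sub>m n - X * Y) $$ (k,y)))"
      using xy X Y by (simp add: B_def scalar_prod_def atLeast0LessThan)
    also have "\<dots> = (\<Sum>k<n. if x = k then (z + w (c x) (c x)) * ((1\<^sub>m n - X * Y) $$ (k,y)) else 0)"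
      by (intro sum.cong) auto
    also have "\<dots> = (z + w (c x) (c x)) * ((if x = y then 1 else 0) - w (c x) (c y) / (z + w (c x) (c x)))"
      using xy X Y XY[OF xy] by (simp del: index_mult_mat(1))
    also have "\<dots> = (z \<cdot>\<^sub>m 1\<^sub>m n - A) $$ (x,y)"
      using xy z[OF c[OF xy(1)]] by (auto simp: A field_simps)
    finally show "(z \<cdot>\<^sub>m 1\<^sub>m n - A) $$ (x,y) = (B * (1\<^sub>m n - X * Y)) $$ (x,y)" ..
  qed (use A B X Y in auto)
  then have "poly (char_poly A) z = det B * det (1\<^sub>m n - X * Y)"
    using det_mult[OF B minus_carrier_mat[OF mult_carrier_mat[OF X Y], of "1\<^sub>m n"]]
    by (subst poly_char_poly[of _ n]) (auto simp: A)
  also have "det (1\<^sub>m n - X * Y) = det (1\<^sub>m m - Y * X)"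
    by (rule det_one_minus_mult_swap[OF X Y])
  also have "1\<^sub>m m - Y * X =
    mat m m (\<lambda>(k,l). (if k = l then 1 else 0) - real (card {x. x < n \<and> c x = k}) * w k l / (z + w k k))"
    using X Y YX by (intro eq_matI) (auto simp del: index_mult_mat(1))
  also have "det B = (\<Prod>x<n. z + w (c x) (c x))"
  proof -
    have "upper_triangular B" by (auto simp: B_def)
    then have "det B = prod_list (diag_mat B)" using B by (rule det_upper_triangular)
    then show ?thesis by (simp add: prod_list_diag_prod B_def atLeast0LessThan)
  qed
  finally show ?thesis .
qed

lemma det_mat_3:
  fixes f :: "nat \<times> nat \<Rightarrow> 'a :: comm_ring_1"
  shows "det (mat 3 3 f) = f (0,0) * (f (1,1) * f (2,2) - f (1,2) * f (2,1))
    - f (0,1) * (f (1,0) * f (2,2) - f (1,2) * f (2,0))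
    + f (0,2) * (f (1,0) * f (2,1) - f (1,1) * f (2,0))"
proof -
  have minor2: "mat_delete (mat 2 2 g) 0 j = mat 1 1 (\<lambda>_. g (1, if 0 < j then 0 else 1))"
    for g :: "nat \<times> nat \<Rightarrow> 'a" and j
    by (rule eq_matI) (auto simp: mat_delete_def)
  have det2: "det (mat 2 2 g) = g (0,0) * g (1,1) - g (0,1) * g (1,0)" for g :: "nat \<times> nat \<Rightarrow> 'a"
  proof -
    have "det (mat 2 2 g) = (\<Sum>j<2. mat 2 2 g $$ (0,j) * cofactor (mat 2 2 g) 0 j)"
      by (rule laplace_expansion_row[of _ 2]) auto
    also have "{..<2::nat} = {0, 1}" by auto
    finally show ?thesis by (simp add: cofactor_def minor2 det_single)
  qed
  have minor: "mat_delete (mat 3 3 f) 0 j =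
      mat 2 2 (\<lambda>(i',j'). f (Suc i', if j' < j then j' else Suc j'))" for j
    by (rule eq_matI) (auto simp: mat_delete_def)
  have "det (mat 3 3 f) = (\<Sum>j<3. mat 3 3 f $$ (0,j) * cofactor (mat 3 3 f) 0 j)"
    by (rule laplace_expansion_row[of _ 3]) auto
  also have "{..<3::nat} = {0, 1, 2}" by auto
  finally have "det (mat 3 3 f) =
      f (0,0) * (f (Suc 0,Suc 0) * f (Suc 1,Suc 1) - f (Suc 0,Suc 1) * f (Suc 1,Suc 0))
    - f (0,1) * (f (Suc 0,0) * f (Suc 1,Suc 1) - f (Suc 0,Suc 1) * f (Suc 1,0))
    + f (0,2) * (f (Suc 0,0) * f (Suc 1,1) - f (Suc 0,1) * f (Suc 1,0))"
    by (simp add: cofactor_def minor det2 algebra_simps)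
  then show ?thesis by (simp add: numeral_2_eq_2 algebra_simps)
qed

text \<open>The characteristic polynomial at \<open>z\<close> of the quotient matrix with rows \<open>(r - 1, s, q)\<close>,
  \<open>(r, s - 1, 2 q)\<close>, \<open>(r, 2 s, e (q - 1))\<close>.\<close>

definition cell_cubic :: "real \<Rightarrow> real \<Rightarrow> real \<Rightarrow> real \<Rightarrow> real \<Rightarrow> real" where
  "cell_cubic r s q e z = 
     (z + 1 - r) * ((z + 1 - s) * (z + e - e * q) - 4 * s * q)
     - r * (s * (z + e - e * q) + 2 * s * q) - r * (2 * s * q + q * (z + 1 - s))"

text \<open>Cell 0 models vertices adjacent to all others, cell 1 a clique, and cell 2 a clique
  (\<open>e = 1\<close>) or an independent set (\<open>e = 2\<close>), with distance 2 between cells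
  1 and 2. The graph K^h_n is the instance r = 1, s = h - 1, q = n - h, e = 2.\<close>

lemma poly_char_poly_three_cells:
  fixes c :: "nat \<Rightarrow> nat" and e :: real
  assumes c: "\<And>x. x < n \<Longrightarrow> c x < 3" and z: "z \<noteq> - 1" "z \<noteq> - e"
    and A: "A = mat n n (\<lambda>(x,y). if x = y then 0 else if c x = 2 \<and> c y = 2 then e
       else if c x \<noteq> 0 \<and> c y \<noteq> 0 \<and> c x \<noteq> c y then 2 else 1)"
    and rsq: "r = card {x. x < n \<and> c x = 0}" "s = card {x. x < n \<and> c x = 1}"
      "q = card {x. x < n \<and> c x = 2}"
    and pos: "0 < r" "0 < s" "0 < q"
  shows "poly (char_poly A) z = (z + 1) ^ (r + s - 2) * (z + e) ^ (q - 1) * cell_cubic r s q e z"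
proof -
  define w :: "nat \<Rightarrow> nat \<Rightarrow> real" where "w k l = (if k = 2 \<and> l = 2 then e
       else if k \<noteq> 0 \<and> l \<noteq> 0 \<and> k \<noteq> l then 2 else 1)" for k l
  have zw: "z + w k k \<noteq> 0" for k using z by (auto simp: w_def)
  have A': "A = mat n n (\<lambda>(x,y). if x = y then 0 else w (c x) (c y))"
    unfolding A by (rule eq_matI) (auto simp: w_def)
  have "(\<Prod>x<n. z + w (c x) (c x)) = (\<Prod>k<3. \<Prod>x\<in>{x\<in>{..<n}. c x = k}. z + w (c x) (c x))"
    using c by (intro prod.group[symmetric]) auto
  also have "\<dots> = (\<Prod>k<3. (z + w k k) ^ card {x. x < n \<and> c x = k})"
    by (intro prod.cong) auto
  also have "{..<3::nat} = {0, 1, 2}" by auto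
  finally have 1: "(\<Prod>x<n. z + w (c x) (c x)) = (z + 1) ^ r * (z + 1) ^ s * (z + e) ^ q"
    by (simp add: rsq w_def mult.assoc)
  obtain r' s' q' where Suc: "r = Suc r'" "s = Suc s'" "q = Suc q'"
    using pos by (metis gr0_conv_Suc)
  define Z where "Z = z + 1" define E where "E = z + e"
  have nz: "Z \<noteq> 0" "E \<noteq> 0" using z by (auto simp: Z_def E_def)
  have cards: "card {x. x < n \<and> c x = 0} = r" "card {x. x < n \<and> c x = Suc 0} = s"
    "card {x. x < n \<and> c x = 2} = q" using rsq by auto
  define f where "f = (\<lambda>(k,l). (if k = l then 1 else 0) - real (card {x. x < n \<and> c x = k}) * w k l / (z + w k k))"
  \<comment> \<open>Each row is multiplied by its own denominator \<open>z + w k k\<close>: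
    \<open>Z\<close> for cells 0 and 1, \<open>E\<close> for cell 2.\<close>
  have "Z * Z * E * det (mat 3 3 f)
    = (Z * f (0,0)) * ((Z * f (1,1)) * (E * f (2,2)) - (Z * f (1,2)) * (E * f (2,1)))
    - (Z * f (0,1)) * ((Z * f (1,0)) * (E * f (2,2)) - (Z * f (1,2)) * (E * f (2,0)))
    + (Z * f (0,2)) * ((Z * f (1,0)) * (E * f (2,1)) - (Z * f (1,1)) * (E * f (2,0)))"
    by (simp add: det_mat_3 algebra_simps)
  also have "\<dots> = cell_cubic r s q e z"
  proof -
    have f: "Z * f (0,0) = Z - r" "Z * f (0,1) = - r" "Z * f (0,2) = - r"
      "Z * f (1,0) = - s" "Z * f (1,1) = Z - s" "Z * f (1,2) = - 2 * s"
      "E * f (2,0) = - q" "E * f (2,1) = - 2 * q" "E * f (2,2) = E - e * q"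
      using nz by (auto simp: f_def cards w_def right_diff_distrib simp flip: Z_def E_def)
    show ?thesis unfolding f cell_cubic_def unfolding Z_def E_def by (simp add: algebra_simps)
  qed
  finally have "Z * Z * E * det (mat 3 3 f) = cell_cubic r s q e z" .
  moreover have "poly (char_poly A) z = Z ^ r * Z ^ s * E ^ q * det (mat 3 3 f)"
    using poly_char_poly_cells[of n c 3 z w A, OF c zw A'] 1 by (simp add: Z_def E_def f_def)
  ultimately show ?thesis
    by (simp add: Suc Z_def[symmetric] E_def[symmetric] power_add mult_ac)
qed

section \<open>The spectrum of the distance matrix\<close>

text \<open>Lifts the cell formula, valid only where its denominators are nonzero, to an identity of
  polynomials.\<close>

lemma poly_eqI_cofinite:
  fixes p q :: "real poly"
  assumes "finite S" and "\<And>z. z \<notin> S \<Longrightarrow> poly p z = poly q z"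
  shows "p = q"
proof (rule ccontr)
  assume "p \<noteq> q"
  then have "finite {z. poly (p - q) z = 0}" by (intro poly_roots_finite) auto
  moreover have "UNIV = S \<union> {z. poly (p - q) z = 0}" using assms(2) by auto
  ultimately show False using assms(1) by (metis finite_UnI infinite_UNIV_char_0)
qed

text \<open>Over the complex numbers the characteristic polynomial splits, so the multiset of roots
  determines it and has the order of the graph as its size. The real polynomial is recovered because
  the embedding of coefficients is injective.\<close>

lemma D_spectrum_eqD:
  assumes "D_spectrum m F = D_spectrum n E"
  shows "m = n" "char_poly (dist_matrix m F) = char_poly (dist_matrix n E)"
proof -
  have D: "dist_matrix k G \<in> carrier_mat k k" for k G by (simp add: dist_matrix_def)
  have fact: "char_poly (map_mat complex_of_real (dist_matrix k G)) = (\<Prod>a\<in>#D_spectrum k G. [:- a, 1:])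
      \<and> size (D_spectrum k G) = k" for k G
  proof -
    obtain as where as: "char_poly (map_mat complex_of_real (dist_matrix k G)) = (\<Prod>a\<leftarrow>as. [:- a, 1:])"
      "length as = k"
      using char_poly_factorized[of "map_mat complex_of_real (dist_matrix k G)" k] D by auto
    have "proots (\<Prod>a\<leftarrow>as. [:- a, 1:]) = mset as" for as :: "complex list"
    proof (induction as)
      case (Cons a as)
      have "(\<Prod>a\<leftarrow>as. [:- a, 1:]) \<noteq> 0" by (auto simp: prod_list_zero_iff)
      then show ?case using Cons by (simp add: proots_mult del: mult_pCons_left)
    qed simp
    then have "D_spectrum k G = mset as" by (simp add: D_spectrum_def as)
    with as show ?thesis by (metis mset_map prod_mset_prod_list size_mset)
  qed
  show "m = n" using fact[of m F] fact[of n E] assms by simp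
  have "map_poly complex_of_real (char_poly (dist_matrix m F)) =
      map_poly complex_of_real (char_poly (dist_matrix n E))"
    using fact[of m F] fact[of n E] assms of_real_hom.char_poly_hom[OF D] by metis
  then show "char_poly (dist_matrix m F) = char_poly (dist_matrix n E)"
    by (simp add: poly_eq_iff coeff_map_poly)
qed

text \<open>\<open>l k\<close> is the k-th vector of an orthonormal eigenbasis. A shift by tI keeps
  the eigenvectors, so one family \<open>l\<close> writes the forms of A - tI as weighted sums of
  squares for every t.\<close>

lemma quadratic_forms_of_spectrum:
  fixes A :: "real mat"
  assumes A: "A \<in> carrier_mat n n" and "transpose_mat A = A"
    and "char_poly A = (\<Prod>e\<leftarrow>es. [:- e, 1:])"
  obtains l where "\<And>i j t. i < n \<Longrightarrow> j < n \<Longrightarrow>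
    A $$ (i,j) - (if i = j then t else 0) = (\<Sum>k<n. (es ! k - t) * l k i * l k j)"
proof -
  obtain P where P: "P \<in> carrier_mat n n" "transpose_mat P * P = 1\<^sub>m n"
    "transpose_mat P * A * P = mat_diag n (\<lambda>i. es ! i)"
    using real_symmetric_diagonalization[OF assms] by auto
  have PPt: "P * transpose_mat P = 1\<^sub>m n"
    using P by (intro mat_mult_left_right_inverse[of "transpose_mat P"]) auto
  have "P * (transpose_mat P * A * P) * transpose_mat P = (P * transpose_mat P) * A * (P * transpose_mat P)"
    using P(1) A by (simp add: assoc_mult_mat[of _ n n _ n _ n])
  then have A_eq: "A = P * mat_diag n (\<lambda>i. es ! i) * transpose_mat P"
    using PPt P A by simp
  have E: "A $$ (i,j) = (\<Sum>k<n. es ! k * P $$ (i,k) * P $$ (j,k))" if "i < n" "j < n" for i j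
  proof -
    have "A $$ (i,j) = (P * mat_diag n (\<lambda>i. es ! i) * transpose_mat P) $$ (i,j)"
      using A_eq by simp
    also have "\<dots> = (\<Sum>k<n. es ! k * P $$ (i,k) * P $$ (j,k))"
      using that P(1) by (subst mat_diag_mult_right[OF P(1)])
        (auto simp: scalar_prod_def atLeast0LessThan mult_ac intro!: sum.cong)
    finally show ?thesis .
  qed
  have I: "(if i = j then 1 else 0) = (\<Sum>k<n. P $$ (i,k) * P $$ (j,k))" if "i < n" "j < n" for i j
  proof -
    have "(P * transpose_mat P) $$ (i,j) = (\<Sum>k<n. P $$ (i,k) * P $$ (j,k))"
      using that P(1) by (simp add: scalar_prod_def atLeast0LessThan)
    then show ?thesis using that by (simp add: PPt)
  qed
  show ?thesis
  proof (rule that[of "\<lambda>k i. P $$ (i,k)"])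
    fix i j t assume ij: "i < n" "j < n"
    have "A $$ (i,j) - (if i = j then t else 0) = A $$ (i,j) - t * (if i = j then 1 else 0)" by simp
    also have "\<dots> = (\<Sum>k<n. es ! k * P $$ (i,k) * P $$ (j,k)) - t * (\<Sum>k<n. P $$ (i,k) * P $$ (j,k))"
      unfolding E[OF ij] I[OF ij] ..
    finally show "A $$ (i,j) - (if i = j then t else 0) = (\<Sum>k<n. (es ! k - t) * P $$ (i,k) * P $$ (j,k))"
      by (simp add: algebra_simps sum_subtractf sum_distrib_left)
  qed
qed

text \<open>Some nontrivial combination of \<open>U\<close> and \<open>W\<close> vanishes at
  \<open>k0\<close>, where alone the weight may be negative, so its value is nonnegative. By
  orthogonality that value is also a combination of two negative numbers with square
  coefficients.\<close>

lemma nonneg_off_one_index: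
  fixes c U W :: "nat \<Rightarrow> real"
  assumes c: "\<And>k. k < n \<Longrightarrow> k \<noteq> k0 \<Longrightarrow> 0 \<le> c k"
    and neg: "(\<Sum>k<n. c k * U k * U k) < 0" "(\<Sum>k<n. c k * W k * W k) < 0"
    and orth: "(\<Sum>k<n. c k * U k * W k) = 0"
  shows False
proof -
  obtain a b where ab: "a * U k0 + b * W k0 = 0" "a \<noteq> 0 \<or> b \<noteq> 0"
    using that[of 1 0] that[of "W k0" "- U k0"] by (cases "U k0 = 0") auto
  have "0 \<le> (\<Sum>k<n. c k * (a * U k + b * W k)\<^sup>2)"
  proof (rule sum_nonneg)
    fix k assume "k \<in> {..<n}"
    then show "0 \<le> c k * (a * U k + b * W k)\<^sup>2" using c[of k] ab(1) by (cases "k = k0") auto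
  qed
  also have "\<dots> = a\<^sup>2 * (\<Sum>k<n. c k * U k * U k) + b\<^sup>2 * (\<Sum>k<n. c k * W k * W k)
      + 2 * a * b * (\<Sum>k<n. c k * U k * W k)"
    by (simp add: sum_distrib_left sum.distrib power2_eq_square algebra_simps)
  finally have "0 \<le> a\<^sup>2 * (\<Sum>k<n. c k * U k * U k) + b\<^sup>2 * (\<Sum>k<n. c k * W k * W k)"
    using orth by simp
  moreover have "a\<^sup>2 * (\<Sum>k<n. c k * U k * U k) \<le> 0" "b\<^sup>2 * (\<Sum>k<n. c k * W k * W k) \<le> 0"
    using neg by (auto intro: mult_nonneg_nonpos)
  moreover have "a\<^sup>2 * (\<Sum>k<n. c k * U k * U k) < 0 \<or> b\<^sup>2 * (\<Sum>k<n. c k * W k * W k) < 0"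
    using neg ab(2) by (auto intro: mult_pos_neg)
  ultimately show False by linarith
qed

lemma two_equations_three_unknowns:
  fixes a1 a2 a3 b1 b2 b3 :: "'a :: field"
  obtains x y z where "a1 * x + a2 * y + a3 * z = 0" "b1 * x + b2 * y + b3 * z = 0"
    "x \<noteq> 0 \<or> y \<noteq> 0 \<or> z \<noteq> 0"
proof (cases "a2 * b3 - a3 * b2 = 0 \<and> a3 * b1 - a1 * b3 = 0 \<and> a1 * b2 - a2 * b1 = 0")
  \<comment> \<open>The cross product of the two coefficient rows; the other case treats parallel
    rows.\<close>
  case False
  show ?thesis
    by (rule that[of "a2 * b3 - a3 * b2" "a3 * b1 - a1 * b3" "a1 * b2 - a2 * b1"])
      (use False in \<open>auto simp: algebra_simps\<close>)
next
  case par: True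
  consider "a1 \<noteq> 0 \<or> a2 \<noteq> 0" | "a1 = 0" "a2 = 0" "a3 \<noteq> 0" | "a1 = 0" "a2 = 0" "a3 = 0" "b1 \<noteq> 0 \<or> b2 \<noteq> 0"
    | "a1 = 0" "a2 = 0" "a3 = 0" "b1 = 0" "b2 = 0" by blast
  then show ?thesis
  proof cases
    case 1 show ?thesis by (rule that[of a2 "- a1" 0]) (use 1 par in \<open>auto simp: algebra_simps\<close>)
  next
    case 2 show ?thesis by (rule that[of a3 0 "- a1"]) (use 2 par in \<open>auto simp: algebra_simps\<close>)
  next
    case 3 show ?thesis by (rule that[of b2 "- b1" 0]) (use 3 in \<open>auto simp: algebra_simps\<close>)
  next
    case 4 show ?thesis by (rule that[of 1 0 0]) (use 4 in auto)
  qed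
qed

text \<open>The same argument with two exceptional indices: three vectors leave room for a
  nontrivial combination that vanishes at both.\<close>

lemma nonpos_off_two_indices:
  fixes c U V W :: "nat \<Rightarrow> real"
  assumes c: "\<And>k. k < n \<Longrightarrow> k \<noteq> k0 \<Longrightarrow> k \<noteq> k1 \<Longrightarrow> c k \<le> 0"
    and pos: "0 < (\<Sum>k<n. c k * U k * U k)" "0 < (\<Sum>k<n. c k * V k * V k)" "0 < (\<Sum>k<n. c k * W k * W k)"
    and orth: "(\<Sum>k<n. c k * U k * V k) = 0" "(\<Sum>k<n. c k * U k * W k) = 0" "(\<Sum>k<n. c k * V k * W k) = 0"
  shows False
proof -
  obtain x y z where xyz: "U k0 * x + V k0 * y + W k0 * z = 0" "U k1 * x + V k1 * y + W k1 * z = 0"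
    "x \<noteq> 0 \<or> y \<noteq> 0 \<or> z \<noteq> 0" by (rule two_equations_three_unknowns)
  have "(\<Sum>k<n. c k * (U k * x + V k * y + W k * z)\<^sup>2) \<le> 0"
  proof (rule sum_nonpos)
    fix k assume "k \<in> {..<n}"
    then show "c k * (U k * x + V k * y + W k * z)\<^sup>2 \<le> 0"
      using c[of k] xyz(1,2) by (cases "k = k0 \<or> k = k1") (auto intro: mult_nonpos_nonneg)
  qed
  moreover have "(\<Sum>k<n. c k * (U k * x + V k * y + W k * z)\<^sup>2) =
      x\<^sup>2 * (\<Sum>k<n. c k * U k * U k) + y\<^sup>2 * (\<Sum>k<n. c k * V k * V k) + z\<^sup>2 * (\<Sum>k<n. c k * W k * W k)
      + 2 * x * y * (\<Sum>k<n. c k * U k * V k) + 2 * x * z * (\<Sum>k<n. c k * U k * W k)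
      + 2 * y * z * (\<Sum>k<n. c k * V k * W k)"
    by (simp add: sum_distrib_left sum.distrib power2_eq_square algebra_simps)
  ultimately have "x\<^sup>2 * (\<Sum>k<n. c k * U k * U k) + y\<^sup>2 * (\<Sum>k<n. c k * V k * V k) + z\<^sup>2 * (\<Sum>k<n. c k * W k * W k) \<le> 0"
    using orth by simp
  moreover have "0 \<le> x\<^sup>2 * (\<Sum>k<n. c k * U k * U k)" "0 \<le> y\<^sup>2 * (\<Sum>k<n. c k * V k * V k)"
    "0 \<le> z\<^sup>2 * (\<Sum>k<n. c k * W k * W k)" using pos by auto
  moreover have "0 < x\<^sup>2 * (\<Sum>k<n. c k * U k * U k) \<or> 0 < y\<^sup>2 * (\<Sum>k<n. c k * V k * V k)
    \<or> 0 < z\<^sup>2 * (\<Sum>k<n. c k * W k * W k)" using pos xyz(3) by auto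
  ultimately show False by linarith
qed

section \<open>Graph distances and the spectrum of K^h_n\<close>

lemma gdist_self [simp]: "gdist E x x = 0"
  unfolding gdist_def by (rule Least_eq_0) simp

lemma gdist_eq_1: "E x y \<Longrightarrow> x \<noteq> y \<Longrightarrow> gdist E x y = 1"
  unfolding gdist_def by (rule Least_equality) (auto simp: Suc_le_eq intro!: gr0I)

lemma gdist_eq_2:
  assumes "E x z" "E z y" "\<not> E x y" "x \<noteq> y"
  shows "gdist E x y = 2"
  unfolding gdist_def
proof (rule Least_equality)
  show "walk E 2 x y" using assms by (auto simp: numeral_2_eq_2)
next
  fix k assume k: "walk E k x y"
  show "2 \<le> k"
  proof (rule ccontr)
    assume "\<not> 2 \<le> k"
    then have "k = 0 \<or> k = Suc 0" by auto
    with k assms show False by auto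
  qed
qed

text \<open>The bilinear form of \<open>D - t I\<close> at the vectors supported on the list \<open>vs\<close> of vertices with
  coefficient lists \<open>u\<close> and \<open>w\<close>.\<close>

definition dform :: "(nat \<Rightarrow> nat \<Rightarrow> nat) \<Rightarrow> real \<Rightarrow> nat list \<Rightarrow> real list \<Rightarrow> real list \<Rightarrow> real" where
  "dform d t vs u w = (\<Sum>i<length vs. \<Sum>j<length vs.
     u ! i * w ! j * (real (d (vs ! i) (vs ! j)) - (if i = j then t else 0)))"

text \<open>Here a = h - 1 counts the clique vertices other than the centre and p = n - h the
  pendant vertices, which are at mutual distance 2.\<close>

abbreviation khn_cubic :: "nat \<Rightarrow> nat \<Rightarrow> real \<Rightarrow> real" where
  "khn_cubic a p \<equiv> cell_cubic 1 (real a) (real p) 2"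

text \<open>Arranged so that most terms vanish at -1/2, -1 and -2; the value is a p at -1 and 3 p (a
  - 1) at -2.\<close>

lemma khn_cubic_eq:
  "khn_cubic a p z = - (real a * real p * (2 * z + 1)) - real a * (z + 1) * (z + 2)
     - real p * (2 * z + 1) * (z + 1) + z * (z + 1) * (z + 2)"
  by (simp add: cell_cubic_def algebra_simps)

lemma cubic_with_two_roots:
  fixes b c d x y :: real
  assumes "x \<noteq> y" and x: "x^3 + b * x^2 + c * x + d = 0" and y: "y^3 + b * y^2 + c * y + d = 0"
  shows "z^3 + b * z^2 + c * z + d = (z - x) * (z - y) * (z - (- b - x - y))"
proof -
  have "(x - y) * (x^2 + x * y + y^2 + b * (x + y) + c) = 0"
    using x y by (simp add: algebra_simps power2_eq_square power3_eq_cube)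
  then have c: "c = - (x^2 + x * y + y^2 + b * (x + y))" using assms(1) by simp
  have "d = - (x^3 + b * x^2 + c * x)" using x by linarith
  then show ?thesis unfolding c by (simp add: algebra_simps power2_eq_square power3_eq_cube)
qed

text \<open>The signs at -1, at -1/2 and far to the right locate \<open>l2\<close> and
  \<open>l1\<close>. The third root comes from the sum of the roots, and positivity of the cubic at
  -2 pushes it below -2.\<close>

lemma khn_cubic_roots:
  assumes "2 \<le> a" "1 \<le> p"
  obtains l1 l2 l3 where "- 1/2 < l1" "- 1 < l2" "l2 < - 1/2" "l3 < - 2"
    "\<And>z. khn_cubic a p z = (z - l1) * (z - l2) * (z - l3)"
proof -
  have a: "2 \<le> real a" and p: "1 \<le> real p" using assms by auto
  define b c d where "b = - (real a + 2 * real p - 3)"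
    and "c = - (2 * real a * real p + 3 * real a + 3 * real p - 2)"
    and "d = - (2 * real a + real p * real a + real p)"
  have f: "khn_cubic a p z = z^3 + b * z^2 + c * z + d" for z
    by (simp add: khn_cubic_eq b_def c_def d_def algebra_simps power2_eq_square power3_eq_cube)
  let ?f = "[:d, c, b, 1:]"
  have pf: "poly ?f z = khn_cubic a p z" for z
    by (simp add: f algebra_simps power2_eq_square power3_eq_cube)
  have half: "poly ?f (- 1/2) < 0"
    unfolding pf khn_cubic_eq using a by simp
  have one: "0 < poly ?f (- 1)" unfolding pf khn_cubic_eq using a p by simp
  have two: "0 < khn_cubic a p (- 2)"
  proof -
    have "khn_cubic a p (- 2) = 3 * (real p * (real a - 1))" by (simp add: khn_cubic_eq algebra_simps)
    then show ?thesis using a p by simp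
  qed
  obtain l2 where l2: "- 1 < l2" "l2 < - 1/2" "poly ?f l2 = 0"
    using poly_IVT_neg[OF _ one half] by auto
  obtain N where N: "\<And>x. N \<le> x \<Longrightarrow> 1 \<le> poly ?f x"
    using poly_pinfty_ge[of ?f 1] by auto
  define M where "M = max N 0"
  have "0 < poly ?f M" "- 1/2 < M" using N[of M] by (auto simp: M_def)
  then obtain l1 where l1: "- 1/2 < l1" "poly ?f l1 = 0"
    using poly_IVT_pos[of "- 1/2" M ?f] half by auto
  define l3 where "l3 = - b - l1 - l2"
  have fact: "khn_cubic a p z = (z - l1) * (z - l2) * (z - l3)" for z
    unfolding f l3_def by (rule cubic_with_two_roots) (use l1 l2 in \<open>auto simp: pf simp flip: f simp del: poly_pCons\<close>)
  have "l3 < - 2"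
  proof (rule ccontr)
    assume "\<not> l3 < - 2"
    moreover have "0 < (- 2 - l1) * (- 2 - l2)" using l1 l2 by (intro mult_neg_neg) auto
    ultimately have "(- 2 - l1) * (- 2 - l2) * (- 2 - l3) \<le> 0" by (intro mult_nonneg_nonpos) auto
    with two fact[of "- 2"] show False by simp
  qed
  with that l1 l2 fact show ?thesis by blast
qed

lemma char_poly_Khn:
  assumes "3 \<le> h" "h \<le> n - 1" and z: "z \<noteq> - 1" "z \<noteq> - 2"
  shows "poly (char_poly (dist_matrix n (Khn h n))) z =
    (z + 1) ^ (h - 2) * (z + 2) ^ (n - h - 1) * khn_cubic (h - 1) (n - h) z"
proof -
  define c :: "nat \<Rightarrow> nat" where "c x = (if x = 0 then 0 else if x < h then 1 else 2)" for x
  have "{x. x < n \<and> c x = 0} = {0}" "{x. x < n \<and> c x = 1} = {1..<h}" "{x. x < n \<and> c x = 2} = {h..<n}"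
    using assms by (auto simp: c_def split: if_splits)
  then have cards: "card {x. x < n \<and> c x = 0} = 1" "card {x. x < n \<and> c x = 1} = h - 1"
    "card {x. x < n \<and> c x = 2} = n - h" by auto
  have A: "dist_matrix n (Khn h n) = mat n n (\<lambda>(x,y). if x = y then 0 else if c x = 2 \<and> c y = 2 then 2
       else if c x \<noteq> 0 \<and> c y \<noteq> 0 \<and> c x \<noteq> c y then 2 else 1)"
  proof (rule eq_matI)
    fix x y assume "x < dim_row (mat n n (\<lambda>(x,y). if x = y then 0 else if c x = 2 \<and> c y = 2 then 2
       else if c x \<noteq> 0 \<and> c y \<noteq> 0 \<and> c x \<noteq> c y then 2 else (1::real)))"
      "y < dim_col (mat n n (\<lambda>(x,y). if x = y then 0 else if c x = 2 \<and> c y = 2 then 2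
       else if c x \<noteq> 0 \<and> c y \<noteq> 0 \<and> c x \<noteq> c y then 2 else (1::real)))"
    then have xy: "x < n" "y < n" by auto
    consider "x = y" | "x \<noteq> y" "Khn h n x y" | "x \<noteq> y" "\<not> Khn h n x y" by blast
    then show "dist_matrix n (Khn h n) $$ (x,y) = mat n n (\<lambda>(x,y). if x = y then 0 else if c x = 2 \<and> c y = 2 then 2
       else if c x \<noteq> 0 \<and> c y \<noteq> 0 \<and> c x \<noteq> c y then 2 else 1) $$ (x,y)"
    proof cases
      case 1 then show ?thesis using xy by (simp add: dist_matrix_def)
    next
      case 2
      then have "gdist (Khn h n) x y = 1" by (intro gdist_eq_1)
      then show ?thesis using 2 xy by (auto simp: dist_matrix_def Khn_def c_def split: if_splits)
    next
      case 3
      then have "gdist (Khn h n) x y = 2" using xy assms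
        by (intro gdist_eq_2[of _ _ 0]) (auto simp: Khn_def)
      then show ?thesis using 3 xy by (auto simp: dist_matrix_def Khn_def c_def split: if_splits)
    qed
  qed (auto simp: dist_matrix_def)
  have "poly (char_poly (dist_matrix n (Khn h n))) z =
     (z + 1) ^ (1 + (h - 1) - 2) * (z + 2) ^ (n - h - 1) * cell_cubic (real 1) (real (h - 1)) (real (n - h)) 2 z"
    using assms z A cards by (intro poly_char_poly_three_cells[of n c]) (auto simp: c_def)
  also have "1 + (h - 1) - 2 = h - 2" using assms by simp
  finally show ?thesis by simp
qed

text \<open>The simple roots head the list, so \<open>l1\<close>, \<open>l2\<close>,
  \<open>l3\<close> have the indices 0, 1, 2 that are exceptional in the sign arguments.\<close>

lemma char_poly_Khn_factorized:
  assumes "3 \<le> h" "h \<le> n - 1"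
    and f: "\<And>z. khn_cubic (h - 1) (n - h) z = (z - l1) * (z - l2) * (z - l3)"
  shows "char_poly (dist_matrix n (Khn h n)) =
    (\<Prod>e\<leftarrow>[l1, l2, l3] @ replicate (h - 2) (- 1) @ replicate (n - h - 1) (- 2). [:- e, 1:])"
proof (rule poly_eqI_cofinite[of "{- 1, - 2}"])
  fix z :: real assume z: "z \<notin> {- 1, - 2}"
  have "poly (char_poly (dist_matrix n (Khn h n))) z =
    (z + 1) ^ (h - 2) * (z + 2) ^ (n - h - 1) * ((z - l1) * (z - l2) * (z - l3))"
    using char_poly_Khn[OF assms(1,2)] z f by simp
  also have "\<dots> = (z - l1) * ((z - l2) * ((z - l3) * ((z + 1) ^ (h - 2) * (z + 2) ^ (n - h - 1))))"
    by (simp only: mult_ac)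
  also have "\<dots> = poly
    (\<Prod>e\<leftarrow>[l1, l2, l3] @ replicate (h - 2) (- 1) @ replicate (n - h - 1) (- 2). [:- e, 1:]) z"
    by (simp del: mult_pCons_left mult_pCons_right add: add.commute)
  finally show "poly (char_poly (dist_matrix n (Khn h n))) z = poly
    (\<Prod>e\<leftarrow>[l1, l2, l3] @ replicate (h - 2) (- 1) @ replicate (n - h - 1) (- 2). [:- e, 1:]) z" .
qed auto

text \<open>At t = -2 only \<open>l3\<close> gives a negative weight; for t between
  \<open>l2\<close> and \<open>l1\<close> only \<open>l1\<close> gives a positive one; at t = -1
  only \<open>l1\<close> and \<open>l2\<close> do. Distinctness of \<open>vs\<close> makes the
  diagonal of the restricted form the diagonal of D - tI.\<close>

lemma Khn_spectral_forms:
  assumes h: "3 \<le> h" "h \<le> n - 1" and sym: "\<And>x y. x < n \<Longrightarrow> y < n \<Longrightarrow> gdist F x y = gdist F y x"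
    and cp: "char_poly (dist_matrix n F) = char_poly (dist_matrix n (Khn h n))"
    and vs: "distinct vs" "set vs \<subseteq> {..<n}"
  shows "dform (gdist F) (- 2) vs u u < 0 \<Longrightarrow> dform (gdist F) (- 2) vs w w < 0 \<Longrightarrow>
      dform (gdist F) (- 2) vs u w = 0 \<Longrightarrow> False"
    and "- 1 < t \<Longrightarrow> khn_cubic (h - 1) (n - h) t < 0 \<Longrightarrow>
      0 < dform (gdist F) t vs u u \<Longrightarrow> 0 < dform (gdist F) t vs w w \<Longrightarrow>
      dform (gdist F) t vs u w = 0 \<Longrightarrow> False"
    and "0 < dform (gdist F) (- 1) vs u u \<Longrightarrow> 0 < dform (gdist F) (- 1) vs v v \<Longrightarrow>
      0 < dform (gdist F) (- 1) vs w w \<Longrightarrow> dform (gdist F) (- 1) vs u v = 0 \<Longrightarrow>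
      dform (gdist F) (- 1) vs u w = 0 \<Longrightarrow> dform (gdist F) (- 1) vs v w = 0 \<Longrightarrow> False"
proof -
  obtain l1 l2 l3 where l: "- 1/2 < l1" "- 1 < l2" "l2 < - 1/2" "l3 < - 2"
    and f: "\<And>z. khn_cubic (h - 1) (n - h) z = (z - l1) * (z - l2) * (z - l3)"
  proof -
    have "2 \<le> h - 1" "1 \<le> n - h" using h by auto
    from khn_cubic_roots[OF this] that show thesis by blast
  qed
  define es where "es = [l1, l2, l3] @ replicate (h - 2) (- 1) @ replicate (n - h - 1) (- 2)"
  have len: "length es = n" using h by (simp add: es_def)
  have tail: "es ! k \<in> {- 1, - 2}" if "k < n" "k \<noteq> 0" "k \<noteq> 1" "k \<noteq> 2" for k
  proof -
    have "drop 3 es ! (k - 3) \<in> set (drop 3 es)" using that len by (intro nth_mem) auto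
    moreover have "drop 3 es ! (k - 3) = es ! k" using that len by (subst nth_drop) auto
    moreover have "set (drop 3 es) \<subseteq> {- 1, - 2}" by (auto simp: es_def)
    ultimately show ?thesis by auto
  qed
  have es012: "es ! 0 = l1" "es ! 1 = l2" "es ! 2 = l3" by (auto simp: es_def)
  let ?D = "dist_matrix n F"
  have D: "?D \<in> carrier_mat n n" by (simp add: dist_matrix_def)
  have Dt: "transpose_mat ?D = ?D" by (rule eq_matI) (auto simp: dist_matrix_def sym)
  have "char_poly ?D = (\<Prod>e\<leftarrow>es. [:- e, 1:])"
    unfolding cp es_def by (rule char_poly_Khn_factorized[OF h f])
  from quadratic_forms_of_spectrum[OF D Dt this] obtain g where g: "\<And>i j t. i < n \<Longrightarrow> j < n \<Longrightarrow>
    ?D $$ (i,j) - (if i = j then t else 0) = (\<Sum>k<n. (es ! k - t) * g k i * g k j)"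
    by blast
  define L where "L u k = (\<Sum>i<length vs. g k (vs ! i) * u ! i)" for u :: "real list" and k
  have form: "dform (gdist F) t vs u w = (\<Sum>k<n. (es ! k - t) * L u k * L w k)" for t u w
  proof -
    have "dform (gdist F) t vs u w = (\<Sum>i<length vs. \<Sum>j<length vs.
       u ! i * w ! j * (\<Sum>k<n. (es ! k - t) * g k (vs ! i) * g k (vs ! j)))"
      unfolding dform_def
    proof (intro sum.cong refl arg_cong2[of _ _ _ _ "(*)"])
      fix i j assume ij: "i \<in> {..<length vs}" "j \<in> {..<length vs}"
      then have lt: "vs ! i < n" "vs ! j < n" using vs(2) nth_mem by blast+
      show "real (gdist F (vs ! i) (vs ! j)) - (if i = j then t else 0) =
          (\<Sum>k<n. (es ! k - t) * g k (vs ! i) * g k (vs ! j))"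
        using g[OF lt, of t] ij vs(1) lt by (simp add: dist_matrix_def nth_eq_iff_index_eq)
    qed
    also have "\<dots> = (\<Sum>i<length vs. \<Sum>j<length vs. \<Sum>k<n.
        (es ! k - t) * (g k (vs ! i) * u ! i) * (g k (vs ! j) * w ! j))"
      by (simp add: sum_distrib_left mult_ac)
    also have "\<dots> = (\<Sum>i<length vs. \<Sum>k<n. \<Sum>j<length vs.
        (es ! k - t) * (g k (vs ! i) * u ! i) * (g k (vs ! j) * w ! j))"
      by (intro sum.cong refl sum.swap)
    also have "\<dots> = (\<Sum>k<n. \<Sum>i<length vs. \<Sum>j<length vs.
        (es ! k - t) * (g k (vs ! i) * u ! i) * (g k (vs ! j) * w ! j))"
      by (rule sum.swap)
    also have "\<dots> = (\<Sum>k<n. (es ! k - t) * L u k * L w k)"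
    proof (rule sum.cong[OF refl])
      fix k
      show "(\<Sum>i<length vs. \<Sum>j<length vs. (es ! k - t) * (g k (vs ! i) * u ! i) * (g k (vs ! j) * w ! j)) =
          (es ! k - t) * L u k * L w k"
        unfolding L_def mult.assoc[of "es ! k - t"] unfolding sum_product unfolding sum_distrib_left ..
    qed
    finally show ?thesis .
  qed
  show False if "dform (gdist F) (- 2) vs u u < 0" "dform (gdist F) (- 2) vs w w < 0"
    "dform (gdist F) (- 2) vs u w = 0"
  proof (rule nonneg_off_one_index[of n 2 "\<lambda>k. es ! k - (- 2)" "L u" "L w"])
    fix k assume "k < n" "k \<noteq> 2"
    then show "0 \<le> es ! k - (- 2)" using tail[of k] l es012 by (cases "k = 0 \<or> k = 1") auto
  qed (use that in \<open>simp_all only: form\<close>)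
  show False if t: "- 1 < t" "khn_cubic (h - 1) (n - h) t < 0" and
    "0 < dform (gdist F) t vs u u" "0 < dform (gdist F) t vs w w" "dform (gdist F) t vs u w = 0"
  proof (rule nonneg_off_one_index[of n 0 "\<lambda>k. - (es ! k - t)" "L u" "L w"])
    \<comment> \<open>A negative value of the cubic at t > -1 > \<open>l3\<close> rules out t below
      or at \<open>l2\<close>, since both other roots would then be at least t.\<close>
    have "l2 < t"
    proof (rule ccontr)
      assume "\<not> l2 < t"
      then have "0 \<le> (t - l1) * (t - l2)" using l by (intro mult_nonpos_nonpos) auto
      then have "0 \<le> (t - l1) * (t - l2) * (t - l3)" using t l by (intro mult_nonneg_nonneg[of "_ * _"]) auto
      then have "0 \<le> khn_cubic (h - 1) (n - h) t" by (simp only: f)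
      with t show False by simp
    qed
    fix k assume "k < n" "k \<noteq> 0"
    then show "0 \<le> - (es ! k - t)" using tail[of k] l es012 t \<open>l2 < t\<close>
      by (cases "k = 1 \<or> k = 2") auto
  qed (use that in \<open>simp_all only: form mult_minus_left sum_negf neg_less_0_iff_less neg_equal_0_iff_equal\<close>)
  show False if "0 < dform (gdist F) (- 1) vs u u" "0 < dform (gdist F) (- 1) vs v v"
      "0 < dform (gdist F) (- 1) vs w w" "dform (gdist F) (- 1) vs u v = 0"
      "dform (gdist F) (- 1) vs u w = 0" "dform (gdist F) (- 1) vs v w = 0"
  proof (rule nonpos_off_two_indices[of n 0 1 "\<lambda>k. es ! k - (- 1)" "L u" "L v" "L w"])
    fix k assume "k < n" "k \<noteq> 0" "k \<noteq> 1"
    then show "es ! k - (- 1) \<le> 0" using tail[of k] l es012 by (cases "k = 2") auto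
  qed (use that in \<open>simp_all only: form\<close>)
qed

section \<open>Forbidden configurations\<close>

lemma walk_append: "walk E k x y \<Longrightarrow> walk E l y z \<Longrightarrow> walk E (k + l) x z"
  by (induction k arbitrary: x) auto

lemma walk_sym:
  assumes "\<And>x y. E x y \<Longrightarrow> E y x"
  shows "walk E k x y \<Longrightarrow> walk E k y x"
proof (induction k arbitrary: x)
  case (Suc k)
  then obtain z where "E x z" "walk E k z y" by auto
  then show ?case using Suc.IH[of z] assms walk_append[of E k y z 1 x] by auto
qed simp

text \<open>Each unordered pair occurs once, so the distances listed above the diagonal in a
  configuration are exactly those that the simplifier meets when it evaluates a certificate.\<close>

lemma dform_ordered:
  assumes "\<And>x y. d x y = d y x" "\<And>x. d x x = 0"
  shows "dform d t vs u w =
    (\<Sum>j<length vs. (\<Sum>i<j. (u ! i * w ! j + u ! j * w ! i) * real (d (vs ! i) (vs ! j))) - t * (u ! j * w ! j))"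
proof -
  define g where "g i j = u ! i * w ! j * (real (d (vs ! i) (vs ! j)) - (if i = j then t else 0))" for i j
  have "(\<Sum>i<m. \<Sum>j<m. g i j) = (\<Sum>j<m. (\<Sum>i<j. g i j + g j i) + g j j)" for m
    by (induction m) (simp_all add: sum.distrib)
  moreover have "(\<Sum>i<j. g i j + g j i) + g j j =
      (\<Sum>i<j. (u ! i * w ! j + u ! j * w ! i) * real (d (vs ! i) (vs ! j))) - t * (u ! j * w ! j)" for j
  proof -
    have "(\<Sum>i<j. g i j + g j i) =
        (\<Sum>i<j. (u ! i * w ! j + u ! j * w ! i) * real (d (vs ! i) (vs ! j)))"
      using assms(1) by (intro sum.cong) (auto simp: g_def algebra_simps)
    moreover have "g j j = - t * (u ! j * w ! j)" using assms(2) by (simp add: g_def)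
    ultimately show ?thesis by simp
  qed
  ultimately show ?thesis unfolding dform_def g_def[symmetric] by simp
qed

locale Khn_cospectral =
  fixes n h :: nat and F :: "nat \<Rightarrow> nat \<Rightarrow> bool"
  assumes h: "3 \<le> h" "h \<le> n - 1"
    and simple: "simple_graph n F" and connected: "connected_graph n F"
    and char_poly_eq: "char_poly (dist_matrix n F) = char_poly (dist_matrix n (Khn h n))"
begin

abbreviation d :: "nat \<Rightarrow> nat \<Rightarrow> nat" where "d \<equiv> gdist F"

lemma edge: "F x y \<Longrightarrow> x < n" "F x y \<Longrightarrow> y < n" "F x y \<Longrightarrow> x \<noteq> y" "F x y \<Longrightarrow> F y x"
  using simple unfolding simple_graph_def by blast+

lemma d_sym: "d x y = d y x"
  unfolding gdist_def using walk_sym[of F, OF edge(4)] by metis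

lemma d_le: "walk F k x y \<Longrightarrow> d x y \<le> k"
  unfolding gdist_def by (rule Least_le)

lemma walk_d: "x < n \<Longrightarrow> y < n \<Longrightarrow> walk F (d x y) x y"
  unfolding gdist_def using connected unfolding connected_graph_def by (metis LeastI_ex)

lemma d_triangle: "x < n \<Longrightarrow> y < n \<Longrightarrow> z < n \<Longrightarrow> d x z \<le> d x y + d y z"
  by (intro d_le walk_append[of F _ x y] walk_d)

lemma d_eq_0_iff: "x < n \<Longrightarrow> y < n \<Longrightarrow> d x y = 0 \<longleftrightarrow> x = y"
  using walk_d[of x y] by (cases "d x y = 0") auto

lemma d_eq_1_iff: "x < n \<Longrightarrow> y < n \<Longrightarrow> d x y = 1 \<longleftrightarrow> F x y"
  using walk_d[of x y] edge(3)[of x y] gdist_eq_1[of F x y] by (cases "d x y = 1") auto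

lemma d_step:
  assumes "x < n" "y < n" "d x y = Suc k"
  obtains z where "F x z" "d z y = k"
proof -
  obtain z where z: "F x z" "walk F k z y" using walk_d[OF assms(1,2)] assms(3) by auto
  have "d x y \<le> d x z + d z y" using edge(2)[OF z(1)] assms by (intro d_triangle)
  moreover have "d x z = 1" using z(1) edge(3)[OF z(1)] by (rule gdist_eq_1)
  ultimately have "d z y = k" using d_le[OF z(2)] assms(3) by simp
  with z(1) show ?thesis by (rule that)
qed

lemma no_negative_pair:
  assumes "distinct vs" "set vs \<subseteq> {..<n}" "dform d (- 2) vs u u < 0" "dform d (- 2) vs w w < 0"
    "dform d (- 2) vs u w = 0"
  shows False
  using Khn_spectral_forms(1)[OF h d_sym char_poly_eq assms(1,2)] assms(3-5) by blast

lemma no_positive_pair: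
  assumes "- 1 < t" "khn_cubic (h - 1) (n - h) t < 0"
    and "distinct vs" "set vs \<subseteq> {..<n}" "0 < dform d t vs u u" "0 < dform d t vs w w"
    "dform d t vs u w = 0"
  shows False
  using Khn_spectral_forms(2)[OF h d_sym char_poly_eq assms(3,4,1,2)] assms(5-7) by blast

text \<open>At -1/2 the factor 2z + 1 removes every term with n - h, and what remains of the cubic
  is negative.\<close>

lemma no_positive_pair_half:
  assumes "distinct vs" "set vs \<subseteq> {..<n}" "0 < dform d (- (1/2)) vs u u" "0 < dform d (- (1/2)) vs w w"
    "dform d (- (1/2)) vs u w = 0"
  shows False
proof -
  have "0 < real (h - 1)" using h by simp
  then have "khn_cubic (h - 1) (n - h) (- (1/2)) < 0" unfolding khn_cubic_eq by (simp del: of_nat_diff)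
  then show False using no_positive_pair[OF _ _ assms(1-5)] by simp
qed

lemma no_positive_triple:
  assumes "distinct vs" "set vs \<subseteq> {..<n}" "0 < dform d (- 1) vs u u" "0 < dform d (- 1) vs v v"
    "0 < dform d (- 1) vs w w" "dform d (- 1) vs u v = 0" "dform d (- 1) vs u w = 0" "dform d (- 1) vs v w = 0"
  shows False
  using Khn_spectral_forms(3)[OF h d_sym char_poly_eq assms(1,2)] assms(3-8) by blast

text \<open>The coefficient lists below are orthogonal vectors for the form of the restricted matrix, found by
  computer search.\<close>

lemma no_C4:
  assumes "{a, b, c, e} \<subseteq> {..<n}"
    and "[d a b, d a c, d a e, d b c, d b e, d c e]
      = [1, 2, 1, 1, 2, 1]"
  shows False
  by (rule no_positive_pair_half[of "[a, b, c, e]" "[0, 0, 0, 1]" "[1, -1, 1, 0]"])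
    (use assms in \<open>auto simp: dform_ordered[OF d_sym gdist_self]\<close>)

text \<open>An induced path on four vertices whose ends have a common neighbour outside it. Ends at
  distance 3 are a separate matter, treated through \<open>geodesic\<close>; once distances are at
  most 2, this excludes all induced P4.\<close>

lemma no_P4_ends_2:
  assumes "{a, b, c, e} \<subseteq> {..<n}"
    and "[d a b, d a c, d a e, d b c, d b e, d c e]
      = [1, 2, 2, 1, 2, 1]"
  shows False
  by (rule no_positive_pair_half[of "[a, b, c, e]" "[0, 0, 0, 1]" "[1, -2, 2, 0]"])
    (use assms in \<open>auto simp: dform_ordered[OF d_sym gdist_self]\<close>)

lemma no_dart:
  assumes "{x, a, b, c, y} \<subseteq> {..<n}"
    and "[d x a, d x b, d x c, d x y, d a b, d a c, d a y, d b c, d b y, d c y]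
      = [1, 1, 1, 1, 1, 2, 2, 1, 2, 2]"
  shows False
  by (rule no_positive_triple[of "[x, a, b, c, y]" "[1, -1, -1, 0, 0]" "[1, 0, 1, -1, 0]" "[1, 1, -1, 1, -1]"])
    (use assms in \<open>auto simp: dform_ordered[OF d_sym gdist_self]\<close>)

lemma no_2K2_K1:
  assumes "{a, b, c, e, x} \<subseteq> {..<n}"
    and "[d a b, d a c, d a e, d a x, d b c, d b e, d b x, d c e, d c x, d e x]
      = [1, 2, 2, 2, 2, 2, 2, 1, 2, 2]"
  shows False
  by (rule no_negative_pair[of "[a, b, c, e, x]" "[0, 0, 1, 1, -2]" "[1, 1, 0, 0, -2]"])
    (use assms in \<open>auto simp: dform_ordered[OF d_sym gdist_self]\<close>)

text \<open>The digits in this and the next four names are the distances of the fifth vertex x from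
  a, b, c, e along a shortest path of length 3.\<close>

lemma no_path_row_1112:
  assumes "{a, b, c, e, x} \<subseteq> {..<n}"
    and "[d a b, d a c, d a e, d a x, d b c, d b e, d b x, d c e, d c x, d e x]
      = [1, 2, 3, 1, 1, 2, 1, 1, 1, 2]"
  shows False
  by (rule no_positive_pair_half[of "[a, b, c, e, x]" "[0, 0, 1, 0, 0]" "[2, -2, 2, -1, -2]"])
    (use assms in \<open>auto simp: dform_ordered[OF d_sym gdist_self]\<close>)

lemma no_path_row_1232:
  assumes "{a, b, c, e, x} \<subseteq> {..<n}"
    and "[d a b, d a c, d a e, d a x, d b c, d b e, d b x, d c e, d c x, d e x]
      = [1, 2, 3, 1, 1, 2, 2, 1, 3, 2]"
  shows False
  by (rule no_negative_pair[of "[a, b, c, e, x]" "[0, 0, 1, 0, -1]" "[1, 1, 0, -1, -1]"])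
    (use assms in \<open>auto simp: dform_ordered[OF d_sym gdist_self]\<close>)

lemma no_path_row_1233:
  assumes "{a, b, c, e, x} \<subseteq> {..<n}"
    and "[d a b, d a c, d a e, d a x, d b c, d b e, d b x, d c e, d c x, d e x]
      = [1, 2, 3, 1, 1, 2, 2, 1, 3, 3]"
  shows False
  by (rule no_negative_pair[of "[a, b, c, e, x]" "[0, 1, 1, 0, -1]" "[2, 2, 1, -2, -2]"])
    (use assms in \<open>auto simp: dform_ordered[OF d_sym gdist_self]\<close>)

lemma no_path_row_1234:
  assumes "{a, b, c, e, x} \<subseteq> {..<n}"
    and "[d a b, d a c, d a e, d a x, d b c, d b e, d b x, d c e, d c x, d e x]
      = [1, 2, 3, 1, 1, 2, 2, 1, 3, 4]"
  shows False
  by (rule no_positive_triple[of "[a, b, c, e, x]" "[0, 0, 0, 0, 1]" "[2, -1, 0, 0, 0]" "[2, 0, -2, 1, 0]"])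
    (use assms in \<open>auto simp: dform_ordered[OF d_sym gdist_self]\<close>)

lemma no_path_row_2112:
  assumes "{a, b, c, e, x} \<subseteq> {..<n}"
    and "[d a b, d a c, d a e, d a x, d b c, d b e, d b x, d c e, d c x, d e x]
      = [1, 2, 3, 2, 1, 2, 1, 1, 1, 2]"
  shows False
  by (rule no_positive_triple[of "[a, b, c, e, x]" "[0, 0, 0, 0, 1]" "[0, 0, 2, -1, 0]" "[1, -2, -1, 0, 1]"])
    (use assms in \<open>auto simp: dform_ordered[OF d_sym gdist_self]\<close>)

text \<open>A purely metric configuration: only a and x are adjacent, and the paths realizing the
  other distances run through further vertices.\<close>

lemma no_edge_at_2_3:
  assumes "{a, x, y, e} \<subseteq> {..<n}"
    and "[d a x, d a y, d a e, d x y, d x e, d y e]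
      = [1, 2, 3, 2, 3, 3]"
  shows False
  by (rule no_negative_pair[of "[a, x, y, e]" "[0, 0, 1, -1]" "[1, 1, -2, 0]"])
    (use assms in \<open>auto simp: dform_ordered[OF d_sym gdist_self]\<close>)

lemma no_path_twin_and_pendant:
  assumes "{a, b, c, e, x, y} \<subseteq> {..<n}"
    and "[d a b, d a c, d a e, d a x, d a y, d b c, d b e, d b x, d b y, d c e, d c x, d c y, d e x, d e y, d x y]
      = [1, 2, 3, 1, 3, 1, 2, 1, 2, 1, 2, 1, 3, 2, 3]"
  shows False
  by (rule no_positive_pair_half[of "[a, b, c, e, x, y]" "[-2, 2, -2, 0, -2, 0]" "[3, -11, 15, -4, 3, -4]"])
    (use assms in \<open>auto simp: dform_ordered[OF d_sym gdist_self]\<close>)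

lemma no_path_two_pendants:
  assumes "{a, b, c, e, x, y} \<subseteq> {..<n}"
    and "[d a b, d a c, d a e, d a x, d a y, d b c, d b e, d b x, d b y, d c e, d c x, d c y, d e x, d e y, d x y]
      = [1, 2, 3, 2, 2, 1, 2, 1, 1, 1, 2, 2, 3, 3, 2]"
  shows False
  by (rule no_positive_pair_half[of "[a, b, c, e, x, y]" "[0, -2, 2, -2, 0, 0]" "[-1, 5, -3, 2, -1, -1]"])
    (use assms in \<open>auto simp: dform_ordered[OF d_sym gdist_self]\<close>)

lemma no_path_opposite_pendants:
  assumes "{a, b, c, e, x, y} \<subseteq> {..<n}"
    and "[d a b, d a c, d a e, d a x, d a y, d b c, d b e, d b x, d b y, d c e, d c x, d c y, d e x, d e y, d x y]
      = [1, 2, 3, 2, 3, 1, 2, 1, 2, 1, 2, 1, 3, 2, 3]"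
  shows False
  by (rule no_positive_pair_half[of "[a, b, c, e, x, y]" "[0, 1, -2, 0, 0, 2]" "[1, -2, 1, -1, 1, 1]"])
    (use assms in \<open>auto simp: dform_ordered[OF d_sym gdist_self]\<close>)

end

section \<open>Diameter at least three\<close>

context Khn_cospectral
begin

lemma eigenvector_exists:
  assumes "poly (char_poly (dist_matrix n F)) e = 0"
  obtains v where "\<exists>x<n. v x \<noteq> 0" "\<And>x. x < n \<Longrightarrow> (\<Sum>y<n. real (d x y) * v y) = e * v x"
proof -
  have D: "dist_matrix n F \<in> carrier_mat n n" by (simp add: dist_matrix_def)
  then obtain w where w: "w \<in> carrier_vec n" "w \<noteq> 0\<^sub>v n" "dist_matrix n F *\<^sub>v w = e \<cdot>\<^sub>v w"
    using assms eigenvalue_root_char_poly[OF D] unfolding eigenvalue_def eigenvector_def by auto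
  show ?thesis
  proof (rule that[of "\<lambda>x. w $ x"])
    show "\<exists>x<n. w $ x \<noteq> 0"
      using w by (metis carrier_vecD eq_vecI index_zero_vec(1) index_zero_vec(2))
    fix x assume x: "x < n"
    then have "(dist_matrix n F *\<^sub>v w) $ x = (\<Sum>y<n. real (d x y) * w $ y)"
      using w(1) by (simp add: dist_matrix_def scalar_prod_def atLeast0LessThan)
    then show "(\<Sum>y<n. real (d x y) * w $ y) = e * w $ x" using w(1,3) x by simp
  qed
qed

definition geodesic :: "nat \<Rightarrow> nat \<Rightarrow> nat \<Rightarrow> nat \<Rightarrow> bool" where
  "geodesic a b c e \<longleftrightarrow> {a, b, c, e} \<subseteq> {..<n} \<and> [d a b, d a c, d a e, d b c, d b e, d c e] = [1, 2, 3, 1, 2, 1]"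

lemma geodesic_rev: "geodesic a b c e \<Longrightarrow> geodesic e c b a"
  by (auto simp: geodesic_def d_sym)

text \<open>The second eigenvalue of \<open>D(P4)\<close> is \<open>- 2 + sqrt 2\<close>, just above \<open>- 293 / 500\<close>; the vector
  \<open>(5, - 12, 12, - 5)\<close> approximates its eigenvector.\<close>

lemma no_geodesic_few_pendants:
  assumes "n - h \<le> 3"
  shows "\<not> geodesic a b c e"
proof
  assume g: "geodesic a b c e"
  obtain A P where AP: "A = real (h - 1)" "P = real (n - h)" by blast
  have A: "2 \<le> A" using h by (simp add: AP)
  have "n - h = 1 \<or> n - h = 2 \<or> n - h = 3" using assms h by auto
  then have P: "P = 1 \<or> P = 2 \<or> P = 3" by (auto simp: AP)
  show False
  proof (rule no_positive_pair[of "- (293/500)" "[a, b, c, e]" "[5, -12, 12, -5]" "[1, 0, 0, 1]"])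
    \<comment> \<open>At this point the coefficient of \<open>A\<close> is about 0.172 P - 0.585,
      which is negative for P up to 3 and positive from 4 on; hence the bound on n - h. The two
      vectors are orthogonal because reversing the path negates the one and fixes the other.\<close>
    show "khn_cubic (h - 1) (n - h) (- (293/500)) < 0"
      unfolding khn_cubic_eq unfolding AP[symmetric] using A P by auto
  qed (use g in \<open>auto simp: geodesic_def dform_ordered[OF d_sym gdist_self]\<close>)
qed

text \<open>The triangle inequality leaves finitely many rows of distances, and forbidden
  configurations remove all but two: x is adjacent to both a and b, or it hangs on b alone.\<close>

lemma row_from_first:
  assumes g: "geodesic a b c e" and x: "x < n" "x \<notin> {a, b, c, e}" and "d a x = 1 \<or> d b x = 1 \<and> 2 \<le> d e x"
  shows "[d a x, d b x, d c x, d e x] \<in> {[1, 1, 2, 3], [2, 1, 2, 3]}"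
proof -
  have lt: "a < n" "b < n" "c < n" "e < n"
    and ds: "d a b = 1" "d a c = 2" "d a e = 3" "d b c = 1" "d b e = 2" "d c e = 1"
    using g by (auto simp: geodesic_def)
  have pos: "d a x \<noteq> 0" "d b x \<noteq> 0" "d c x \<noteq> 0" "d e x \<noteq> 0"
    using x lt by (auto simp: d_eq_0_iff)
  have tri: "d u x \<le> d u v + d v x" "d u v \<le> d u x + d v x" if "u < n" "v < n" for u v
    using that x d_triangle[of u v x] d_triangle[of u x v] d_sym[of x v] by auto
  have bounds: "d a x \<le> 1 + d b x" "d b x \<le> 1 + d a x" "d b x \<le> 1 + d c x" "d c x \<le> 1 + d b x"
    "d c x \<le> 1 + d e x" "d e x \<le> 1 + d c x" "3 \<le> d a x + d e x" "2 \<le> d a x + d c x" "2 \<le> d b x + d e x"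
    using tri[of a b] tri[of b a] tri[of b c] tri[of c b] tri[of c e] tri[of e c] tri[of a e] tri[of a c] tri[of b e]
    by (simp_all add: lt ds d_sym[of b a] d_sym[of c b] d_sym[of e c])
  have 1: "d a x = 1 \<or> d a x = 2" "d b x = 1 \<or> d b x = 2" "d c x = 1 \<or> d c x = 2 \<or> d c x = 3"
    "d e x = 2 \<or> d e x = 3 \<or> d e x = 4"
    using assms(4) bounds pos by arith+
  have sub: "{a, b, c, e, x} \<subseteq> {..<n}" "{x, b, c, e} \<subseteq> {..<n}" "{x, a, b, c} \<subseteq> {..<n}" "{a, b, c, x} \<subseteq> {..<n}"
    using lt x by auto
  have "\<not> [d a x, d b x, d c x, d e x] = [1, 1, 1, 2]" "\<not> [d a x, d b x, d c x, d e x] = [1, 2, 3, 2]"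
    "\<not> [d a x, d b x, d c x, d e x] = [1, 2, 3, 3]" "\<not> [d a x, d b x, d c x, d e x] = [1, 2, 3, 4]"
    "\<not> [d a x, d b x, d c x, d e x] = [2, 1, 1, 2]"
    using no_path_row_1112[OF sub(1)] no_path_row_1232[OF sub(1)] no_path_row_1233[OF sub(1)]
      no_path_row_1234[OF sub(1)] no_path_row_2112[OF sub(1)] by (auto simp: ds)
  moreover have "\<not> [d b x, d c x, d e x] = [1, 2, 2]"
    using no_P4_ends_2[OF sub(2)] by (auto simp: ds d_sym[of x])
  moreover have "\<not> [d a x, d b x, d c x] = [1, 2, 2]"
    using no_P4_ends_2[OF sub(3)] by (auto simp: ds d_sym[of x])
  moreover have "\<not> [d a x, d b x, d c x] = [1, 2, 1]"
    using no_C4[OF sub(4)] by (auto simp: ds)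
  ultimately show ?thesis
    using 1 by (elim disjE; use bounds assms(4) in simp)
qed

lemma row_adjacent:
  assumes g: "geodesic a b c e" and x: "x < n" "x \<notin> {a, b, c, e}"
    and "d a x = 1 \<or> d b x = 1 \<or> d c x = 1 \<or> d e x = 1"
  shows "[d a x, d b x, d c x, d e x] \<in> {[1, 1, 2, 3], [2, 1, 2, 3], [3, 2, 1, 1], [3, 2, 1, 2]}"
proof -
  have ge: "d a x \<noteq> 0" "d e x \<noteq> 0" "\<not> (d a x = 1 \<and> d e x = 1)"
    using g x d_triangle[of a x e] by (auto simp: geodesic_def d_eq_0_iff d_sym[of x e])
  consider "d a x = 1 \<or> d b x = 1 \<and> 2 \<le> d e x" | "d e x = 1 \<or> d c x = 1 \<and> 2 \<le> d a x"
    using assms(4) ge by force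
  then show ?thesis
  proof cases
    case 1 then show ?thesis using row_from_first[OF g x] by auto
  next
    case 2 then show ?thesis using row_from_first[OF geodesic_rev[OF g], of x] x by auto
  qed
qed

text \<open>A vertex y with distances 1, 2, 3 from b, c, e can replace a in the geodesic. Applied to
  the new geodesic, \<open>row_from_first\<close> makes its neighbour x adjacent to b, hence to the
  original path. Thus the four rows spread along edges to the whole connected graph.\<close>

lemma row_neighbour:
  assumes g: "geodesic a b c e" and F: "F y x" and x: "x \<notin> {a, b, c, e}"
    and y: "y \<in> {a, b, c, e} \<or> [d a y, d b y, d c y, d e y] \<in> {[1, 1, 2, 3], [2, 1, 2, 3], [3, 2, 1, 1], [3, 2, 1, 2]}"
  shows "[d a x, d b x, d c x, d e x] \<in> {[1, 1, 2, 3], [2, 1, 2, 3], [3, 2, 1, 1], [3, 2, 1, 2]}"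
proof -
  have lt: "x < n" "y < n" "y \<noteq> x" and yx: "d y x = 1" using edge[OF F] gdist_eq_1[of F y x] F by auto
  consider "y \<in> {a, b, c, e}" | "[d b y, d c y, d e y] = [1, 2, 3]" | "[d a y, d b y, d c y] = [3, 2, 1]"
    using y by auto
  then show ?thesis
  proof cases
    case 1
    with yx show ?thesis by (intro row_adjacent[OF g lt(1) x]) auto
  next
    case 2
    then have "geodesic y b c e" using g lt(2) by (simp add: geodesic_def d_sym[of y])
    from row_from_first[OF this lt(1)] yx x lt(3) have "d b x = 1" by auto
    then show ?thesis using row_adjacent[OF g lt(1) x] by auto
  next
    case 3
    then have "geodesic y c b a" using geodesic_rev[OF g] lt(2) by (simp add: geodesic_def d_sym[of y])
    from row_from_first[OF this lt(1)] yx x lt(3) have "d c x = 1" by auto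
    then show ?thesis using row_adjacent[OF g lt(1) x] by auto
  qed
qed

lemma row_all:
  assumes g: "geodesic a b c e" and x: "x < n" "x \<notin> {a, b, c, e}"
  shows "[d a x, d b x, d c x, d e x] \<in> {[1, 1, 2, 3], [2, 1, 2, 3], [3, 2, 1, 1], [3, 2, 1, 2]}"
proof -
  have "x \<in> {a, b, c, e} \<or> [d a x, d b x, d c x, d e x] \<in> {[1, 1, 2, 3], [2, 1, 2, 3], [3, 2, 1, 1], [3, 2, 1, 2]}"
    if "walk F k x a" "x < n" for k x
    using that
  proof (induction k arbitrary: x)
    case 0 then show ?case by simp
  next
    case (Suc k)
    then obtain y where y: "F x y" "walk F k y a" by auto
    note IH = Suc.IH[OF y(2) edge(2)[OF y(1)]]
    show ?case
    proof (cases "x \<in> {a, b, c, e}")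
      case False
      from row_neighbour[OF g edge(4)[OF y(1)] this IH] show ?thesis ..
    qed (rule disjI1)
  qed
  moreover have "walk F (d x a) x a" using g x by (intro walk_d) (auto simp: geodesic_def)
  ultimately have "x \<in> {a, b, c, e} \<or> [d a x, d b x, d c x, d e x] \<in> {[1, 1, 2, 3], [2, 1, 2, 3], [3, 2, 1, 1], [3, 2, 1, 2]}"
    using x(1) .
  then show ?thesis using x(2) by (elim disjE) simp_all
qed

text \<open>The certificates against x hanging on b involve a further vertex y, which the lower
  bound on n supplies. For each of the four rows of y, every possible value of d x y completes a
  forbidden configuration.\<close>

lemma row_not_pendant:
  assumes g: "geodesic a b c e" and n: "7 \<le> n" and x: "x < n" "[d a x, d b x, d c x, d e x] = [2, 1, 2, 3]"
  shows False
proof -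
  have lt: "a < n" "b < n" "c < n" "e < n"
    and ds: "d a b = 1" "d a c = 2" "d a e = 3" "d b c = 1" "d b e = 2" "d c e = 1"
    and dx: "d a x = 2" "d b x = 1" "d c x = 2" "d e x = 3"
    using g x by (auto simp: geodesic_def)
  have "card {a, b, c, e, x} \<le> 5" by (simp add: card_insert_if)
  moreover have "\<not> {..<n} \<subseteq> {a, b, c, e, x}"
    using card_mono[of "{a, b, c, e, x}" "{..<n}"] \<open>card {a, b, c, e, x} \<le> 5\<close> n by auto
  ultimately obtain y where y: "y < n" "y \<notin> {a, b, c, e}" "y \<noteq> x" by auto
  have xy0: "d x y \<noteq> 0" using x y by (auto simp: d_eq_0_iff)
  have tri: "d x y \<le> d v x + d v y" "d v x \<le> d v y + d x y" if "v < n" for v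
    using that x y d_triangle[of x v y] d_triangle[of v y x] d_sym[of x v] d_sym[of x y] by auto
  note sym = d_sym[of x a] d_sym[of x b] d_sym[of x c] d_sym[of x e] d_sym[of y a] d_sym[of y b] d_sym[of y c] d_sym[of y e]
    d_sym[of y x] d_sym[of b a] d_sym[of c a] d_sym[of e a] d_sym[of c b] d_sym[of e b] d_sym[of e c]
  have P4: "d b y = 2 \<Longrightarrow> d c y = 1 \<Longrightarrow> d x y \<noteq> 2"
    using no_P4_ends_2[of x b c y] lt x y by (auto simp: sym ds dx)
  from row_all[OF g y(1,2)] consider "[d a y, d b y, d c y, d e y] = [1, 1, 2, 3]" | "[d a y, d b y, d c y, d e y] = [2, 1, 2, 3]"
    | "[d a y, d b y, d c y, d e y] = [3, 2, 1, 1]" | "[d a y, d b y, d c y, d e y] = [3, 2, 1, 2]" by blast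
  then show False
  proof cases
    case 1
    then have "d x y = 1 \<or> d x y = 2" using tri(1)[OF lt(2)] xy0 dx by auto
    then show False
      using 1 no_dart[of b a y x c] no_edge_at_2_3[of a y x e] lt x y by (auto simp: sym ds dx)
  next
    case 2
    then have "d x y = 1 \<or> d x y = 2" using tri(1)[OF lt(2)] xy0 dx by auto
    then show False
      using 2 no_edge_at_2_3[of x y a e] no_path_two_pendants[of a b c e x y] lt x y by (auto simp: sym ds dx)
  next
    case 3
    then have "d x y = 2 \<or> d x y = 3" using tri(1)[OF lt(2)] tri(2)[OF lt(4)] xy0 dx by auto
    then show False
      using 3 P4 no_path_twin_and_pendant[of e c b a y x] lt x y by (auto simp: sym ds dx)
  next
    case 4
    then have "d x y = 1 \<or> d x y = 2 \<or> d x y = 3" using tri(1)[OF lt(2)] xy0 dx by auto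
    then show False
      using 4 P4 no_C4[of x b c y] no_path_opposite_pendants[of a b c e x y] lt x y by (auto simp: sym ds dx)
  qed
qed

end

section \<open>Excluding distance three\<close>

context Khn_cospectral
begin

lemma minus_two_root: "2 \<le> n - h \<Longrightarrow> poly (char_poly (dist_matrix n F)) (- 2) = 0"
proof -
  assume p: "2 \<le> n - h"
  have "2 \<le> h - 1" "1 \<le> n - h" using h by auto
  from khn_cubic_roots[OF this] obtain l1 l2 l3 where
    f: "\<And>z. khn_cubic (h - 1) (n - h) z = (z - l1) * (z - l2) * (z - l3)" by metis
  from p obtain k where "n - h - 1 = Suc k" by (cases "n - h - 1") auto
  then show ?thesis
    unfolding char_poly_eq char_poly_Khn_factorized[OF h f] by simp
qed

lemma less_minus_two_root: obtains e where "e < - 2" "poly (char_poly (dist_matrix n F)) e = 0"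
proof -
  have "2 \<le> h - 1" "1 \<le> n - h" using h by auto
  from khn_cubic_roots[OF this] obtain l1 l2 l3 where "l3 < - 2" and
    f: "\<And>z. khn_cubic (h - 1) (n - h) z = (z - l1) * (z - l2) * (z - l3)" by metis
  moreover have "poly (char_poly (dist_matrix n F)) l3 = 0"
    unfolding char_poly_eq char_poly_Khn_factorized[OF h f] by simp
  ultimately show ?thesis using that by blast
qed

text \<open>An eigenvector for -2 is constant on each clique, since a row inside a clique expresses
  its entry by the two clique sums and the values at b and c. The eigenvalue equation thus becomes a
  system in four unknowns with only the zero solution.\<close>

lemma not_dumbbell:
  assumes p: "2 \<le> n - h" and part: "{..<n} = A \<union> B \<union> {b, c}" "A \<inter> B = {}" "b \<notin> A \<union> B" "c \<notin> A \<union> B" "b \<noteq> c"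
    and A: "A \<noteq> {}" "\<And>x y. x \<in> A \<Longrightarrow> y \<in> A \<Longrightarrow> x \<noteq> y \<Longrightarrow> d x y = 1"
      "\<And>x. x \<in> A \<Longrightarrow> d x b = 1" "\<And>x. x \<in> A \<Longrightarrow> d x c = 2"
    and B: "B \<noteq> {}" "\<And>x y. x \<in> B \<Longrightarrow> y \<in> B \<Longrightarrow> x \<noteq> y \<Longrightarrow> d x y = 1"
      "\<And>x. x \<in> B \<Longrightarrow> d x b = 2" "\<And>x. x \<in> B \<Longrightarrow> d x c = 1"
    and AB: "\<And>x y. x \<in> A \<Longrightarrow> y \<in> B \<Longrightarrow> d x y = 3" and bc: "d b c = 1"
  shows False
proof -
  obtain v where v: "\<exists>x<n. v x \<noteq> 0" "\<And>x. x < n \<Longrightarrow> (\<Sum>y<n. real (d x y) * v y) = (- 2) * v x"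
    using eigenvector_exists[OF minus_two_root[OF p]] by blast
  have fin: "finite A" "finite B" using part(1) by (metis finite_Un finite_lessThan)+
  have split: "(\<Sum>y<n. g y) = sum g A + sum g B + g b + g c" for g :: "nat \<Rightarrow> real"
    unfolding part(1) using fin part(2-) by (subst sum.union_disjoint; simp add: sum.union_disjoint Int_commute)
  define SA SB where "SA = sum v A" and "SB = sum v B"
  have lt: "\<And>x. x \<in> A \<Longrightarrow> x < n" "\<And>x. x \<in> B \<Longrightarrow> x < n" "b < n" "c < n" using part(1) by auto
  have clique_sum: "(\<Sum>y\<in>C. real (d x y) * v y) = sum v C - v x"
    if "x \<in> C" "finite C" "\<And>x y. x \<in> C \<Longrightarrow> y \<in> C \<Longrightarrow> x \<noteq> y \<Longrightarrow> d x y = 1" for x C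
  proof -
    have "(\<Sum>y\<in>C. real (d x y) * v y) = (\<Sum>y\<in>C - {x}. v y)"
      using that by (subst sum.remove[of _ x]) (auto intro!: sum.cong)
    then show ?thesis using that by (simp add: sum_diff1)
  qed
  have const_sum: "(\<Sum>y\<in>C. real (d x y) * v y) = real k * sum v C" if "\<And>y. y \<in> C \<Longrightarrow> d x y = k" for x k C
    using that by (simp add: sum_distrib_left)
  note row = v(2)[unfolded split]
  have vA: "v x = - (SA + v b + 2 * v c + 3 * SB)" if x: "x \<in> A" for x
    using row[OF lt(1)[OF x]] clique_sum[OF x fin(1) A(2)] const_sum[of B x 3] AB[OF x] A(3,4)[OF x]
    by (simp add: SA_def SB_def)
  have vB: "v x = - (SB + v c + 2 * v b + 3 * SA)" if x: "x \<in> B" for x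
    using row[OF lt(2)[OF x]] clique_sum[OF x fin(2) B(2)] const_sum[of A x 3] AB[OF _ x] B(3,4)[OF x] d_sym[of x]
    by (simp add: SA_def SB_def)
  have vb: "SA + 2 * SB + v c = - 2 * v b"
    using row[OF lt(3)] const_sum[of A b 1] const_sum[of B b 2] A(3) B(3) bc d_sym[of b]
    by (simp add: SA_def SB_def)
  have vc: "2 * SA + SB + v b = - 2 * v c"
    using row[OF lt(4)] const_sum[of A c 2] const_sum[of B c 1] A(4) B(4) bc d_sym[of c]
    by (simp add: SA_def SB_def)
  define s t where "s = real (card A)" and "t = real (card B)"
  have st: "1 \<le> s" "1 \<le> t" using A(1) B(1) fin by (auto simp: s_def t_def Suc_le_eq card_gt_0_iff)
  \<comment> \<open>The row of c eliminates \<open>v b\<close> and \<open>v c\<close> from the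
    entries on \<open>A\<close>, and the row of b does so on \<open>B\<close>.\<close>
  have K: "- (SA + v b + 2 * v c + 3 * SB) = SA - 2 * SB" "- (SB + v c + 2 * v b + 3 * SA) = SB - 2 * SA"
    using vb vc by linarith+
  have "sum v A = (\<Sum>x\<in>A. SA - 2 * SB)" by (intro sum.cong refl vA[unfolded K])
  then have SA: "SA = s * (SA - 2 * SB)" by (simp only: sum_constant SA_def[symmetric] s_def)
  have "sum v B = (\<Sum>x\<in>B. SB - 2 * SA)" by (intro sum.cong refl vB[unfolded K])
  then have SB: "SB = t * (SB - 2 * SA)" by (simp only: sum_constant SB_def[symmetric] t_def)
  have "(s - 1) * SA = 2 * s * SB" "(t - 1) * SB = 2 * t * SA"
    using SA SB by (simp_all only: left_diff_distrib right_diff_distrib)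
  then have "((s - 1) * SA) * ((t - 1) * SB) = (2 * s * SB) * (2 * t * SA)" by (rule arg_cong2)
  \<comment> \<open>Up to sign the factor is the determinant (s - 1)(t - 1) - 4 s t of the system in
    \<open>SA\<close> and \<open>SB\<close>.\<close>
  moreover have "(3 * (s * t) + s + t - 1) * (SA * SB) = (2 * s * SB) * (2 * t * SA) - ((s - 1) * SA) * ((t - 1) * SB)"
    by (simp add: algebra_simps)
  ultimately have "(3 * (s * t) + s + t - 1) * (SA * SB) = 0" by linarith
  moreover have "0 < 3 * (s * t) + s + t - 1" using st mult_nonneg_nonneg[of s t] by linarith
  ultimately have "SA = 0 \<or> SB = 0" by simp
  then have "SA = 0 \<and> SB = 0" using SA SB st by auto
  then have S0: "SA = 0" "SB = 0" by auto
  then have "v b = 0" "v c = 0" using vb vc S0 by auto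
  have "v x = 0" if "x < n" for x
  proof -
    have "x \<in> A \<union> B \<union> {b, c}" using that part(1) by blast
    then show ?thesis using vA[unfolded K] vB[unfolded K] S0 \<open>v b = 0\<close> \<open>v c = 0\<close> by auto
  qed
  with v(1) show False by blast
qed

lemma no_geodesic: "\<not> geodesic a b c e"
proof
  assume g: "geodesic a b c e"
  have p: "3 < n - h" using no_geodesic_few_pendants g by force
  then have n: "7 \<le> n" using h by auto
  have lt: "a < n" "b < n" "c < n" "e < n"
    and ds: "d a b = 1" "d a c = 2" "d a e = 3" "d b c = 1" "d b e = 2" "d c e = 1"
    using g by (auto simp: geodesic_def)
  have ne: "a \<noteq> b" "a \<noteq> c" "a \<noteq> e" "b \<noteq> c" "b \<noteq> e" "c \<noteq> e" using ds by auto
  \<comment> \<open>Only distances to b, c, e enter, so that a itself belongs to \<open>A\<close>;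
    symmetrically e belongs to \<open>B\<close>.\<close>
  define A where "A = {x. x < n \<and> [d b x, d c x, d e x] = [1, 2, 3]}"
  define B where "B = {x. x < n \<and> [d a x, d b x, d c x] = [3, 2, 1]}"
  have A_row: "x = a \<or> d a x = 1" if "x \<in> A" for x
  proof (rule ccontr)
    assume "\<not> (x = a \<or> d a x = 1)"
    moreover have "x \<notin> {a, b, c, e}" "x < n" using that ne ds \<open>\<not> (x = a \<or> d a x = 1)\<close> by (auto simp: A_def)
    ultimately show False
      using row_all[OF g, of x] row_not_pendant[OF g n, of x] that by (auto simp: A_def)
  qed
  have B_row: "x = e \<or> d e x = 1" if "x \<in> B" for x
  proof (rule ccontr)
    assume "\<not> (x = e \<or> d e x = 1)"
    moreover have "x \<notin> {a, b, c, e}" "x < n" using that ne ds \<open>\<not> (x = e \<or> d e x = 1)\<close> by (auto simp: B_def)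
    ultimately show False
      using row_all[OF g, of x] row_not_pendant[OF geodesic_rev[OF g] n, of x] that by (auto simp: B_def)
  qed
  show False
  proof (rule not_dumbbell[of A B b c])
    have "x \<in> A \<union> B \<union> {b, c}" if "x < n" for x
      using row_all[OF g that] that ds d_sym[of b a] d_sym[of c a] d_sym[of e a] d_sym[of c b] d_sym[of e b] d_sym[of e c]
      by (auto simp: A_def B_def)
    then show "{..<n} = A \<union> B \<union> {b, c}" using lt by (auto simp: A_def B_def)
    show "A \<inter> B = {}" "b \<notin> A \<union> B" "c \<notin> A \<union> B" by (auto simp: A_def B_def)
    have "a \<in> A" "e \<in> B" using lt ds by (auto simp: A_def B_def d_sym[of _ a] d_sym[of c b] d_sym[of e b])
    then show "A \<noteq> {}" "B \<noteq> {}" by auto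
    show "d x b = 1" "d x c = 2" if "x \<in> A" for x using that by (auto simp: A_def d_sym[of x])
    show "d x b = 2" "d x c = 1" if "x \<in> B" for x using that by (auto simp: B_def d_sym[of x])
    show "d x y = 1" if xy: "x \<in> A" "y \<in> A" "x \<noteq> y" for x y
    proof (cases "x = a \<or> y = a")
      case True then show ?thesis using xy A_row[of x] A_row[of y] by (auto simp: d_sym[of x a])
    next
      case False
      have lt': "x < n" "y < n" and dx: "d b x = 1" "d c x = 2" "d b y = 1" "d c y = 2" "d a x = 1" "d a y = 1"
        using xy False A_row by (auto simp: A_def)
      have "d x y \<noteq> 0" "d x y \<le> 2"
        using xy lt' lt dx d_triangle[of x b y] by (auto simp: d_eq_0_iff d_sym[of x b])
      \<comment> \<open>Otherwise x, a, y is an induced path below the common neighbour b, and c,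
        adjacent only to b among these, completes a dart.\<close>
      moreover have "d x y \<noteq> 2"
        using no_dart[of b x a y c] lt lt' ds dx by (auto simp: d_sym[of b a] d_sym[of x a] d_sym[of x c] d_sym[of y c])
      ultimately show ?thesis by auto
    qed
    show "d x y = 1" if xy: "x \<in> B" "y \<in> B" "x \<noteq> y" for x y
    proof (cases "x = e \<or> y = e")
      case True then show ?thesis using xy B_row[of x] B_row[of y] by (auto simp: d_sym[of x e])
    next
      case False
      have lt': "x < n" "y < n" and dx: "d b x = 2" "d c x = 1" "d b y = 2" "d c y = 1" "d e x = 1" "d e y = 1"
        using xy False B_row by (auto simp: B_def)
      have "d x y \<noteq> 0" "d x y \<le> 2"
        using xy lt' lt dx d_triangle[of x c y] by (auto simp: d_eq_0_iff d_sym[of x c])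
      moreover have "d x y \<noteq> 2"
        using no_dart[of c x e y b] lt lt' ds dx
        by (auto simp: d_sym[of c b] d_sym[of e b] d_sym[of x e] d_sym[of x b] d_sym[of y b])
      ultimately show ?thesis by auto
    qed
    show "d x y = 3" if xy: "x \<in> A" "y \<in> B" for x y
    proof -
      have lt': "x < n" "y < n" and dx: "d b x = 1" "d c x = 2" "d e x = 3" "d b y = 2" "d c y = 1" "y = e \<or> d e y = 1"
        using xy B_row by (auto simp: A_def B_def)
      have "d x y \<le> 3" using d_triangle[of x b y] lt lt' dx by (simp add: d_sym[of x b])
      moreover have "2 \<le> d x y"
        using d_triangle[of x y e] lt lt' dx by (auto simp: d_sym[of y e] d_sym[of x e])
      moreover have "d x y \<noteq> 2"
        using no_P4_ends_2[of x b c y] lt lt' ds dx by (auto simp: d_sym[of x b] d_sym[of x c])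
      ultimately show ?thesis by auto
    qed
  qed (use p ds ne in auto)
qed

text \<open>Along a shortest path to y the distance drops by one at each step, so a larger distance
  would produce a vertex at distance exactly 3 from y and with it a geodesic.\<close>

lemma d_le_2:
  assumes "x < n" "y < n"
  shows "d x y \<le> 2"
proof (rule ccontr)
  assume "\<not> d x y \<le> 2"
  then obtain k where k: "d x y = k + 3" by (metis add.commute less_eqE not_less_eq_eq numeral_2_eq_2 numeral_3_eq_3)
  have "\<exists>a<n. d a y = 3" if "x < n" "d x y = k + 3" for k x
    using that
  proof (induction k arbitrary: x)
    case (Suc k)
    then obtain z where "F x z" "d z y = k + 3" using d_step[of x y "k + 3"] assms(2) by auto
    then show ?case using Suc.IH edge(2) by blast
  qed auto
  from this[OF assms(1) k]
  obtain a where a: "a < n" "d a y = 3" by blast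
  obtain b where b: "F a b" "d b y = 2" using d_step[OF a(1) assms(2), of 2] a(2) by auto
  obtain c where c: "F b c" "d c y = 1" using d_step[OF edge(2)[OF b(1)] assms(2), of 1] b(2) by auto
  have lt: "b < n" "c < n" using edge b c by auto
  have ab: "d a b = 1" "d b c = 1" using b c edge gdist_eq_1 by auto
  have "d a c \<le> 2" "3 \<le> d a c + 1"
    using d_triangle[of a b c] d_triangle[of a c y] a b c ab lt assms by auto
  then have "geodesic a b c y" using a b c ab lt assms by (auto simp: geodesic_def)
  then show False using no_geodesic by blast
qed

end

section \<open>Diameter at most two\<close>

lemma cell_cubic_poly:
  fixes r s q e :: real
  shows "\<exists>P. \<forall>z. poly P z = cell_cubic r s q e z"
  by (rule exI[of _ "[:1 - r, 1:] * ([:1 - s, 1:] * [:e - e * q, 1:] - [:4 * s * q:])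
     - [:r:] * ([:s:] * [:e - e * q, 1:] + [:2 * s * q:]) - [:r:] * ([:2 * s * q:] + [:q:] * [:1 - s, 1:])"])
    (simp add: cell_cubic_def algebra_simps)

text \<open>Both exponents are the multiplicity of the root -c, as neither cofactor vanishes
  there.\<close>

lemma linear_power_cancel:
  fixes P Q :: "real poly"
  assumes "[:c, 1:] ^ i * P = [:c, 1:] ^ j * Q" "poly P (- c) \<noteq> 0" "poly Q (- c) \<noteq> 0"
  shows "i = j" "P = Q"
proof -
  have le: "j \<le> i" if "[:c, 1:] ^ i * P = [:c, 1:] ^ j * Q" "poly P (- c) \<noteq> 0"
    for i j and P Q :: "real poly"
  proof (rule ccontr)
    assume "\<not> j \<le> i"
    then obtain k where "j = i + Suc k" by (metis add_Suc_right less_imp_Suc_add not_le)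
    with that(1) have "[:c, 1:] ^ i * P = [:c, 1:] ^ i * ([:c, 1:] ^ Suc k * Q)"
      by (simp only: power_add mult.assoc)
    then have "P = [:c, 1:] ^ Suc k * Q" by (subst (asm) mult_left_cancel) simp_all
    with that(2) show False by simp
  qed
  show "i = j" using le[OF assms(1,2)] le[OF assms(1)[symmetric] assms(3)] by simp
  with assms(1) have "[:c, 1:] ^ i * P = [:c, 1:] ^ i * Q" by simp
  moreover have "[:c, 1:] ^ i \<noteq> 0" by simp
  ultimately show "P = Q" by (metis mult_left_cancel)
qed

lemma graph_iso_Khn:
  assumes simple: "simple_graph n F" and h: "0 < h" "h \<le> n"
    and part: "{..<n} = {x0} \<union> S \<union> Q" "x0 \<notin> S" "x0 \<notin> Q" "S \<inter> Q = {}"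
    and card: "card S = h - 1"
    and F: "\<And>x y. x < n \<Longrightarrow> y < n \<Longrightarrow> F x y \<longleftrightarrow> x \<noteq> y \<and> (x = x0 \<or> y = x0 \<or> x \<in> S \<and> y \<in> S)"
  shows "graph_iso n F n (Khn h n)"
proof -
  have fin: "finite S" "finite Q" using part(1) by (metis finite_Un finite_lessThan)+
  have "card {..<n} = 1 + card S + card Q"
    unfolding part(1) using fin part(2-) by (subst card_Un_disjoint; simp add: card_insert_if)
  then have "card Q = n - h" using card h by simp
  obtain f where f: "bij_betw f S {1..<h}"
    using finite_same_card_bij[of S "{1..<h}"] fin card by auto
  obtain g where g: "bij_betw g Q {h..<n}"
    using finite_same_card_bij[of Q "{h..<n}"] fin \<open>card Q = n - h\<close> by auto
  define k where "k x = (if x = x0 then 0 else if x \<in> S then f x else g x)" for x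
  have kS: "k x \<in> {1..<h}" if "x \<in> S" for x
    using that f part by (auto simp: k_def bij_betw_def)
  have kQ: "k x \<in> {h..<n}" if "x \<in> Q" for x
    using that g part by (auto simp: k_def bij_betw_def)
  have "bij_betw k S {1..<h}"
    using f by (rule bij_betw_cong[THEN iffD1, rotated]) (use part in \<open>auto simp: k_def\<close>)
  moreover have "bij_betw k Q {h..<n}"
    using g by (rule bij_betw_cong[THEN iffD1, rotated]) (use part in \<open>auto simp: k_def\<close>)
  moreover have "bij_betw k {x0} {0}" by (simp add: k_def bij_betw_def)
  ultimately have "bij_betw k ({x0} \<union> S \<union> Q) ({0} \<union> {1..<h} \<union> {h..<n})"
    by (intro bij_betw_combine) (use h part in auto)
  moreover have "{0} \<union> {1..<h} \<union> {h..<n} = {..<n}" using h by auto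
  ultimately have bij: "bij_betw k {..<n} {..<n}" using part(1) by simp
  have "F x y \<longleftrightarrow> Khn h n (k x) (k y)" if xy: "x < n" "y < n" for x y
  proof -
    have inj: "k x = k y \<longleftrightarrow> x = y" "k x < n" "k y < n"
      using bij xy by (auto simp: bij_betw_def inj_on_def)
    have cell: "k z = 0 \<longleftrightarrow> z = x0" "k z < h \<longleftrightarrow> z \<notin> Q" "h \<le> k z \<longleftrightarrow> z \<in> Q" "z \<in> S \<longleftrightarrow> z \<noteq> x0 \<and> z \<notin> Q"
      if "z < n" for z
    proof -
      have "z = x0 \<or> z \<in> S \<or> z \<in> Q" using that part(1) by blast
      then show "k z = 0 \<longleftrightarrow> z = x0" "k z < h \<longleftrightarrow> z \<notin> Q" "h \<le> k z \<longleftrightarrow> z \<in> Q" "z \<in> S \<longleftrightarrow> z \<noteq> x0 \<and> z \<notin> Q"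
        using kS[of z] kQ[of z] part(2-) h(1) by (auto simp: k_def)
    qed
    show ?thesis
      unfolding Khn_def F[OF xy] inj(1) cell[OF xy(1)] cell[OF xy(2)] using inj(2,3) part(3) by blast
  qed
  then show ?thesis unfolding graph_iso_def using bij by blast
qed

text \<open>Writing r = x + 1, s = y + 1, t = z + 1 turns the equation into xyz + xy + xz + yz = 0,
  so at least two of x, y, z vanish.\<close>

lemma mult_eq_add_minus_2:
  fixes r s t :: nat
  assumes "0 < r" "0 < s" "0 < t" "r * s * t + 2 = r + s + t"
  shows "r = 1 \<and> (s = 1 \<or> t = 1) \<or> s = 1 \<and> t = 1"
proof -
  obtain x y z where "r = Suc x" "s = Suc y" "t = Suc z" using assms(1-3) gr0_conv_Suc by metis
  with assms(4) show ?thesis by (auto simp: algebra_simps)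
qed

section \<open>Structure of a cospectral graph of diameter at most two\<close>

context Khn_cospectral
begin

lemma gdist_eq:
  assumes "x < n" "y < n"
  shows "d x y = (if x = y then 0 else if F x y then 1 else 2)"
  using d_le_2[OF assms] d_eq_0_iff[OF assms] d_eq_1_iff[OF assms] by auto

lemma no_induced_path_or_square:
  assumes "F a b" "F b c" "F c e" "\<not> F a c" "\<not> F b e" "a \<noteq> c" "b \<noteq> e"
  shows False
proof -
  have ne: "a \<noteq> e" using assms edge by blast
  have lt: "a < n" "b < n" "c < n" "e < n" using assms edge by blast+
  show False
    using no_C4[of a b c e] no_P4_ends_2[of a b c e] lt assms ne edge(3)[of a b] edge(3)[of b c] edge(3)[of c e]
    by (cases "F a e") (auto simp: gdist_eq)
qed

definition dominating :: "nat set" where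
  "dominating = {x. x < n \<and> (\<forall>y<n. y \<noteq> x \<longrightarrow> F x y)}"

text \<open>A vertex of maximum degree is dominating: otherwise it is the second vertex of an induced path or
  square.\<close>

lemma dominating_nonempty: "dominating \<noteq> {}"
proof -
  let ?N = "\<lambda>x. {y. F x y}"
  have fin: "finite (?N x)" for x by (rule finite_subset[of _ "{..<n}"]) (auto dest: edge(2))
  have "0 < n" using h by simp
  then obtain x where x: "x < n" "\<And>y. y < n \<Longrightarrow> card (?N y) \<le> card (?N x)"
  proof -
    let ?M = "(\<lambda>x. card (?N x)) ` {..<n}"
    have "Max ?M \<in> ?M" using \<open>0 < n\<close> by (intro Max_in) auto
    then obtain x where "x < n" "card (?N x) = Max ?M" by auto
    moreover have "card (?N y) \<le> Max ?M" if "y < n" for y using that by (intro Max_ge) auto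
    ultimately show thesis using that by metis
  qed
  have "F x y" if y: "y < n" "y \<noteq> x" for y
  proof (rule ccontr)
    assume "\<not> F x y"
    then have "d x y = Suc 1" using gdist_eq x y by simp
    then obtain u where u: "F x u" "d u y = 1" using d_step x(1) y(1) by blast
    then have uy: "F u y" using d_eq_1_iff edge y by blast
    \<comment> \<open>If u were adjacent to all other neighbours of x, then with x and y added its
      degree would exceed the maximum by one.\<close>
    have "\<exists>z. F x z \<and> z \<noteq> u \<and> \<not> F u z"
    proof (rule ccontr)
      assume "\<not> ?thesis"
      then have "insert y (insert x (?N x - {u})) \<subseteq> ?N u" using u(1) uy edge by blast
      then have "card (insert y (insert x (?N x - {u}))) \<le> card (?N u)" using fin card_mono by blast
      moreover have "x \<notin> ?N x" using edge by blast
      moreover have "card (insert y (insert x (?N x - {u}))) = Suc (Suc (card (?N x) - 1))"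
        using \<open>\<not> F x y\<close> \<open>x \<notin> ?N x\<close> y u(1) fin by (simp add: card_insert_if card_Diff_singleton_if)
      moreover have "card (?N u) \<le> card (?N x)" using x(2) edge u(1) by blast
      moreover have "0 < card (?N x)" using u(1) fin card_gt_0_iff by blast
      ultimately show False by linarith
    qed
    then obtain z where z: "F x z" "z \<noteq> u" "\<not> F u z" by blast
    show False
      by (rule no_induced_path_or_square[of z x u y]) (use z u uy y \<open>\<not> F x y\<close> edge in blast)+
  qed
  then show ?thesis using x(1) unfolding dominating_def by auto
qed

text \<open>Outside the dominating vertices the components are cliques. An induced path a, b, c with
  b missing some y forces y to miss a and c as well, and a dominating x above all four completes a
  dart.\<close>

lemma adjacent_trans:
  assumes "F a b" "F b c" "a \<noteq> c" "b \<notin> dominating"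
  shows "F a c"
proof (rule ccontr)
  assume ac: "\<not> F a c"
  have lt: "a < n" "b < n" "c < n" using assms edge by blast+
  then obtain y where y: "y < n" "y \<noteq> b" "\<not> F b y" using assms(4) by (auto simp: dominating_def)
  obtain x where x: "x < n" "\<And>y. y < n \<Longrightarrow> y \<noteq> x \<Longrightarrow> F x y"
    using dominating_nonempty unfolding dominating_def by blast
  have "\<not> F y a"
    using no_induced_path_or_square[of y a b c] assms ac y edge by blast
  moreover have "\<not> F y c"
    using no_induced_path_or_square[of y c b a] assms ac y edge by blast
  moreover have "x \<noteq> y" using y x lt edge by blast
  moreover have "x \<noteq> a" using x(2)[OF lt(3)] assms(3) ac by auto
  moreover have "x \<noteq> c" using x(2)[OF lt(1)] assms(3) ac edge(4) by auto
  moreover have "x \<noteq> b" using x(2)[OF y(1)] y(2,3) by auto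
  moreover have "y \<noteq> a" "y \<noteq> c" using y assms edge by blast+
  ultimately have adj: "F x a" "F x b" "F x c" "F x y" and ne: "y \<noteq> a" "y \<noteq> c" "y \<noteq> b"
    and nadj: "\<not> F a y" "\<not> F c y" "x \<noteq> a" "x \<noteq> b" "x \<noteq> c" "x \<noteq> y"
    using x(2) lt y edge(4) by auto
  have "a \<noteq> b" "b \<noteq> c" using assms edge(3) by auto
  then show False
    using no_dart[of x a b c y] adj ne nadj x(1) lt y assms(1-3) ac by (simp add: gdist_eq)
qed

text \<open>The distance matrix of a complete graph is J - I, whose eigenvalues are at least -1,
  whereas F has an eigenvalue below -2.\<close>

lemma not_complete: "dominating \<noteq> {..<n}"
proof
  assume dom: "dominating = {..<n}"
  obtain e where e: "e < - 2" "poly (char_poly (dist_matrix n F)) e = 0" using less_minus_two_root by blast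
  obtain v where v: "\<exists>x<n. v x \<noteq> 0" "\<And>x. x < n \<Longrightarrow> (\<Sum>y<n. real (d x y) * v y) = e * v x"
    using eigenvector_exists[OF e(2)] by blast
  define S where "S = sum v {..<n}"
  have vx: "v x = S / (1 + e)" if x: "x < n" for x
  proof -
    have "F x y" if "y < n" "y \<noteq> x" for y using that x dom unfolding dominating_def by blast
    then have "(\<Sum>y\<in>{..<n} - {x}. real (d x y) * v y) = sum v ({..<n} - {x})"
      using x by (intro sum.cong) (auto simp: gdist_eq)
    then have "(\<Sum>y<n. real (d x y) * v y) = S - v x"
      using x unfolding S_def by (subst sum.remove[of _ x]) (auto simp: sum_diff1)
    then show ?thesis using v(2)[OF x] e(1) by (simp add: field_simps)
  qed
  have "sum v {..<n} = (\<Sum>x<n. S / (1 + e))" by (intro sum.cong refl vx) simp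
  then have "S = real n * (S / (1 + e))" by (simp only: S_def[symmetric] sum_constant card_lessThan)
  then have "S * (1 + e - real n) = 0" using e(1) by (simp add: field_simps)
  then have "S = 0" using e(1) by auto
  then show False using v(1) vx by auto
qed

lemma cells:
  obtains S Q e where "e = 1 \<or> e = (2::nat)" "{..<n} = dominating \<union> S \<union> Q" "dominating \<inter> S = {}"
    "dominating \<inter> Q = {}" "S \<inter> Q = {}" "S \<noteq> {}" "Q \<noteq> {}"
    "\<And>x y. x \<in> S \<Longrightarrow> y \<in> S \<Longrightarrow> x \<noteq> y \<Longrightarrow> F x y"
    "\<And>x y. x \<in> S \<Longrightarrow> y \<in> Q \<Longrightarrow> \<not> F x y"
    "\<And>x y. x \<in> Q \<Longrightarrow> y \<in> Q \<Longrightarrow> x \<noteq> y \<Longrightarrow> F x y \<longleftrightarrow> e = 1"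
proof -
  define H where "H = {..<n} - dominating"
  have sub: "dominating \<subseteq> {..<n}" by (auto simp: dominating_def)
  have "H \<noteq> {}" using not_complete sub by (auto simp: H_def)
  have trans: "F a b \<Longrightarrow> F b c \<Longrightarrow> a \<noteq> c \<Longrightarrow> b \<in> H \<Longrightarrow> F a c" for a b c
    using adjacent_trans by (auto simp: H_def)
  \<comment> \<open>\<open>s\<close> is taken in a component with an edge whenever one exists. An
    edge inside \<open>Q\<close> then comes with an edge inside \<open>S\<close>, and a vertex of
    \<open>Q\<close> off that first edge's clique would give 2K2 + K1.\<close>
  obtain s where s: "s \<in> H" "(\<exists>x\<in>H. \<exists>y\<in>H. F x y) \<Longrightarrow> \<exists>y\<in>H. F s y"
    using \<open>H \<noteq> {}\<close> by blast
  define S where "S = {x\<in>H. x = s \<or> F s x}"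
  define Q where "Q = H - S"
  have SQ: "\<not> F x y" if "x \<in> S" "y \<in> Q" for x y
    using that trans[of s x y] by (auto simp: S_def Q_def)
  obtain y where y: "y < n" "y \<noteq> s" "\<not> F s y" using s(1) by (auto simp: H_def dominating_def)
  have "y \<in> H" using y s(1) edge(4) by (auto simp: H_def dominating_def)
  then have "Q \<noteq> {}" using y by (auto simp: Q_def S_def)
  have all_or_none: "F x y" if uv: "u \<in> Q" "v \<in> Q" "F u v" and xy: "x \<in> Q" "y \<in> Q" "x \<noteq> y" for u v x y
  proof (rule ccontr)
    assume nxy: "\<not> F x y"
    have H: "u \<in> H" "v \<in> H" "x \<in> H" "y \<in> H" using uv xy by (auto simp: Q_def)
    obtain w where w: "w \<in> Q" "w \<noteq> u" "\<not> F u w"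
    proof -
      have "\<not> (F u x \<and> F u y)" using trans[of x u y] nxy xy H edge(4) by blast
      then show thesis using that[of x] that[of y] xy nxy edge(4) by blast
    qed
    have wv: "w \<noteq> v" "\<not> F v w" using w uv trans[of u v w] H by auto
    obtain t where t: "t \<in> H" "F s t" using s(2) uv(3) H by blast
    have tS: "s \<in> S" "t \<in> S" using s(1) t by (auto simp: S_def)
    have nF: "\<not> F s u" "\<not> F s v" "\<not> F s w" "\<not> F t u" "\<not> F t v" "\<not> F t w"
      using SQ tS uv w by auto
    have ne: "s \<noteq> u" "s \<noteq> v" "s \<noteq> w" "t \<noteq> u" "t \<noteq> v" "t \<noteq> w" "s \<noteq> t" "u \<noteq> v"
      using tS uv w t edge(3) by (auto simp: Q_def)
    have lt: "s < n" "t < n" "u < n" "v < n" "w < n" using H t s(1) w(1) by (auto simp: H_def Q_def)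
    show False
      using no_2K2_K1[of s t u v w] lt nF ne w wv uv(3) t(2) by (auto simp: gdist_eq)
  qed
  show ?thesis
  \<comment> \<open>A single vertex in \<open>Q\<close> receives the default
    \<open>e = 2\<close>.\<close>
  proof (rule that[of "if \<exists>u\<in>Q. \<exists>v\<in>Q. F u v then 1 else 2" S Q])
    show "{..<n} = dominating \<union> S \<union> Q" using sub by (auto simp: Q_def S_def H_def)
    show "dominating \<inter> S = {}" "dominating \<inter> Q = {}" "S \<inter> Q = {}" by (auto simp: Q_def S_def H_def)
    show "S \<noteq> {}" using s(1) by (auto simp: S_def)
    show "F x y" if "x \<in> S" "y \<in> S" "x \<noteq> y" for x y
      using that trans[of x s y] s(1) edge(4) by (auto simp: S_def)
    show "F x y \<longleftrightarrow> (if \<exists>u\<in>Q. \<exists>v\<in>Q. F u v then 1 else 2) = (1::nat)" if "x \<in> Q" "y \<in> Q" "x \<noteq> y" for x y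
    proof (cases "\<exists>u\<in>Q. \<exists>v\<in>Q. F u v")
      case True
      then show ?thesis using all_or_none[OF _ _ _ that] by auto
    next
      case False
      then show ?thesis using that by auto
    qed
  qed (use \<open>Q \<noteq> {}\<close> SQ in auto)
qed

lemma graph_iso: "graph_iso n F n (Khn h n)"
proof -
  obtain S Q e where e: "e = 1 \<or> e = (2::nat)" and part: "{..<n} = dominating \<union> S \<union> Q" "dominating \<inter> S = {}"
    "dominating \<inter> Q = {}" "S \<inter> Q = {}" and ne: "S \<noteq> {}" "Q \<noteq> {}"
    and S: "\<And>x y. x \<in> S \<Longrightarrow> y \<in> S \<Longrightarrow> x \<noteq> y \<Longrightarrow> F x y"
    and SQ: "\<And>x y. x \<in> S \<Longrightarrow> y \<in> Q \<Longrightarrow> \<not> F x y"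
    and Q: "\<And>x y. x \<in> Q \<Longrightarrow> y \<in> Q \<Longrightarrow> x \<noteq> y \<Longrightarrow> F x y \<longleftrightarrow> e = 1"
    by (rule cells) (rule that)
  have QS: "\<not> F x y" if "x \<in> Q" "y \<in> S" for x y using SQ that edge(4) by blast
  have dom: "F x y" "F y x" if "x \<in> dominating" "y < n" "x \<noteq> y" for x y
    using that edge(4) unfolding dominating_def by blast+
  have fin: "finite dominating" "finite S" "finite Q" using part(1) by (metis finite_Un finite_lessThan)+
  define r s q where "r = card dominating" and "s = card S" and "q = card Q"
  have pos: "0 < r" "0 < s" "0 < q"
    using fin ne dominating_nonempty by (auto simp: r_def s_def q_def card_gt_0_iff)
  have "card {..<n} = r + s + q"
    unfolding part(1) r_def s_def q_def using fin part(2-) by (subst card_Un_disjoint; auto simp: card_Un_disjoint)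
  then have n: "n = r + s + q" by simp
  define c :: "nat \<Rightarrow> nat" where "c x = (if x \<in> dominating then 0 else if x \<in> S then 1 else 2)" for x
  have cells: "{x. x < n \<and> c x = 0} = dominating" "{x. x < n \<and> c x = 1} = S" "{x. x < n \<and> c x = 2} = Q"
    using part by (auto simp: c_def split: if_splits)
  let ?M = "mat n n (\<lambda>(x,y). if x = y then 0 else if c x = 2 \<and> c y = 2 then real e
       else if c x \<noteq> 0 \<and> c y \<noteq> 0 \<and> c x \<noteq> c y then 2 else 1)"
  have A: "dist_matrix n F = ?M"
  proof (rule eq_matI)
    fix x y assume "x < dim_row ?M" "y < dim_col ?M"
    then have xy: "x < n" "y < n" by auto
    have cell: "x \<in> dominating \<and> c x = 0 \<or> x \<in> S \<and> c x = 1 \<or> x \<in> Q \<and> c x = 2" if "x < n" for x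
    proof -
      have "x \<in> dominating \<or> x \<in> S \<or> x \<in> Q" using that part(1) by blast
      then show ?thesis using part(2-) by (auto simp: c_def)
    qed
    have "real (d x y) = (if x = y then 0 else if c x = 2 \<and> c y = 2 then real e
       else if c x \<noteq> 0 \<and> c y \<noteq> 0 \<and> c x \<noteq> c y then 2 else 1)"
      using cell[OF xy(1)] cell[OF xy(2)] S[of x y] SQ[of x y] QS[of x y] Q[of x y] dom(1)[of x y] dom(2)[of y x] e
      by (elim disjE conjE) (simp_all add: gdist_eq xy)
    then show "dist_matrix n F $$ (x, y) = ?M $$ (x, y)" using xy by (simp add: dist_matrix_def)
  qed (auto simp: dist_matrix_def)
  obtain G where G: "\<And>z. poly G z = cell_cubic r s q e z" using cell_cubic_poly by metis
  obtain K where K: "\<And>z. poly K z = khn_cubic (h - 1) (n - h) z" using cell_cubic_poly by metis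
  define a p where "a = h - 1" and "p = n - h"
  have a: "2 \<le> a" and p: "1 \<le> p" and nap: "n = a + p + 1" and ap2: "h - 2 = a - 1" "n - h - 1 = p - 1"
    using h by (auto simp: a_def p_def)
  have eq: "[:1, 1:] ^ (r + s - 2) * ([:real e, 1:] ^ (q - 1) * G) = [:1, 1:] ^ (a - 1) * ([:2, 1:] ^ (p - 1) * K)"
  proof (rule poly_eqI_cofinite[of "{- 1, - 2}"])
    fix z :: real assume "z \<notin> {- 1, - 2}"
    then have z: "z \<noteq> - 1" "z \<noteq> - 2" "z \<noteq> - real e" using e by auto
    have "c x < 3" for x by (simp add: c_def)
    then have "poly (char_poly (dist_matrix n F)) z = (z + 1) ^ (r + s - 2) * (z + real e) ^ (q - 1) * cell_cubic r s q e z"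
      using poly_char_poly_three_cells[OF _ z(1,3) A, of r s q] pos cells by (simp add: r_def s_def q_def)
    moreover have "poly (char_poly (dist_matrix n F)) z = (z + 1) ^ (a - 1) * (z + 2) ^ (p - 1) * poly K z"
      unfolding char_poly_eq char_poly_Khn[OF h z(1,2)] K ap2 ..
    ultimately show "poly ([:1, 1:] ^ (r + s - 2) * ([:real e, 1:] ^ (q - 1) * G)) z =
        poly ([:1, 1:] ^ (a - 1) * ([:2, 1:] ^ (p - 1) * K)) z"
      by (simp add: G add.commute mult.assoc)
  qed auto
  \<comment> \<open>The values at -1 are positive on both sides, so the multiplicities of the root
    -1 can be compared; after cancellation these values give r s q = a p.\<close>
  have K1: "poly K (- 1) = real (a * p)" unfolding K khn_cubic_eq a_def p_def by simp
  have K2: "poly K (- 2) \<noteq> 0"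
  proof -
    have "poly K (- 2) = 3 * real p * (real a - 1)"
      unfolding K khn_cubic_eq a_def[symmetric] p_def[symmetric] by (simp add: algebra_simps)
    then show ?thesis using a p by auto
  qed
  have G1: "poly G (- 1) = real (r * s * q)" unfolding G cell_cubic_def by (simp add: algebra_simps)
  have rsq: "G = K \<and> r * s * q = a * p \<and> (e = 2 \<and> r + s = a + 1 \<and> q = p \<or> e = 1 \<and> p = 1 \<and> r + s + q = a + 2)"
    using e
  proof
    assume e2: "e = 2"
    have *: "[:1, 1:] ^ (r + s - 2) * ([:2, 1:] ^ (q - 1) * G) = [:1, 1:] ^ (a - 1) * ([:2, 1:] ^ (p - 1) * K)"
      using eq e2 by simp
    have nz: "poly ([:2, 1:] ^ (q - 1) * G) (- 1) \<noteq> 0" "poly ([:2, 1:] ^ (p - 1) * K) (- 1) \<noteq> 0"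
      using G1 K1 pos a p by auto
    have rs: "r + s - 2 = a - 1" by (rule linear_power_cancel(1)[OF *]) (use nz in simp_all)
    then have "q = p" "r + s = a + 1" using nap n pos a by auto
    moreover have "[:2, 1:] ^ (q - 1) * G = [:2, 1:] ^ (p - 1) * K"
      by (rule linear_power_cancel(2)[OF *]) (use nz in simp_all)
    ultimately have "G = K" by (simp add: mult_left_cancel)
    then have "real (r * s * q) = real (a * p)" using G1 K1 by simp
    then show ?thesis using \<open>G = K\<close> e2 \<open>q = p\<close> \<open>r + s = a + 1\<close> by (simp only: of_nat_eq_iff) simp
  next
    assume e1: "e = 1"
    have *: "[:1, 1:] ^ (r + s - 2 + (q - 1)) * G = [:1, 1:] ^ (a - 1) * ([:2, 1:] ^ (p - 1) * K)"
      using eq e1 by (simp only: power_add mult.assoc of_nat_1)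
    have nz: "poly G (- 1) \<noteq> 0" "poly ([:2, 1:] ^ (p - 1) * K) (- 1) \<noteq> 0"
      using G1 K1 pos a p by auto
    \<comment> \<open>Equal multiplicities together with n = r + s + q = a + p + 1 leave p =
      1.\<close>
    have "r + s - 2 + (q - 1) = a - 1" by (rule linear_power_cancel(1)[OF *]) (use nz in simp_all)
    then have "p = 1" "r + s + q = a + 2" using nap n pos a by auto
    moreover have "G = [:2, 1:] ^ (p - 1) * K"
      by (rule linear_power_cancel(2)[OF *]) (use nz in simp_all)
    ultimately have "G = K" by simp
    then have "real (r * s * q) = real (a * p)" using G1 K1 by simp
    then show ?thesis using \<open>G = K\<close> e1 \<open>p = 1\<close> \<open>r + s + q = a + 2\<close> by (simp only: of_nat_eq_iff) simp
  qed
  \<comment> \<open>In these cases \<open>S\<close> and \<open>Q\<close> together form an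
    independent set, whose q + 1 nonadjacent twins supply the eigenvalue -2 once more than the power
    of z + 2 accounts for.\<close>
  have not_book: "\<not> (s = 1 \<and> (e = 2 \<or> q = 1))"
  proof
    assume "s = 1 \<and> (e = 2 \<or> q = 1)"
    then have "poly G (- 2) = 0" using e unfolding G cell_cubic_def by (auto simp: algebra_simps)
    with K2 rsq show False by simp
  qed
  \<comment> \<open>For e = 2 the relations reduce to r s + 1 = r + s, and for e = 1 to r s q + 2 =
    r + s + q.\<close>
  have sizes: "r = 1 \<and> (e = 2 \<and> s = a \<or> q = 1 \<and> s = a \<or> e = 1 \<and> s = 1 \<and> q = a)"
  proof (cases "e = 2")
    case True
    then have "r * s * 1 + 2 = r + s + 1" using rsq p by auto
    from mult_eq_add_minus_2[OF pos(1,2) _ this] not_book True rsq show ?thesis by auto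
  next
    case False
    then have "r * s * q + 2 = r + s + q" using rsq e by auto
    from mult_eq_add_minus_2[OF pos this] not_book False e rsq show ?thesis by auto
  qed
  obtain x0 where x0: "dominating = {x0}" using sizes by (auto simp: r_def card_1_singleton_iff)
  have Fx0: "F x y" if "x = x0 \<or> y = x0" "x < n" "y < n" "x \<noteq> y" for x y
    using that dom x0 by auto
  have irrefl: "\<not> F x x" for x using edge(3) by blast
  have h': "0 < h" "h \<le> n" using h by auto
  consider "s = a" "e = 2 \<or> q = 1" | "e = 1" "s = 1" "q = a" using sizes by blast
  then show ?thesis
  proof cases
    case 1
    have nQ: "\<not> F x y" if "x \<in> Q" "y \<in> Q" for x y
    proof (cases "x = y")
      case False
      then have "q \<noteq> 1" using that unfolding q_def by (auto simp: card_1_singleton_iff)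
      then show ?thesis using 1 Q[OF that False] by auto
    qed (use irrefl in simp)
    show ?thesis
    proof (rule graph_iso_Khn[OF simple h', of x0 S Q])
      fix x y assume xy: "x < n" "y < n"
      then have "x = x0 \<or> x \<in> S \<or> x \<in> Q" "y = x0 \<or> y \<in> S \<or> y \<in> Q" using part(1) x0 by auto
      then show "F x y \<longleftrightarrow> x \<noteq> y \<and> (x = x0 \<or> y = x0 \<or> x \<in> S \<and> y \<in> S)"
        using Fx0[of x y] xy S[of x y] SQ[of x y] QS[of x y] nQ[of x y] part(4) irrefl by auto
    qed (use part x0 1 in \<open>auto simp: s_def a_def\<close>)
  next
    case 2
    \<comment> \<open>The roles are exchanged here: \<open>Q\<close> is the large clique and the
      single vertex of \<open>S\<close> is the pendant one.\<close>
    obtain s0 where s0: "S = {s0}" using 2 by (auto simp: s_def card_1_singleton_iff)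
    show ?thesis
    proof (rule graph_iso_Khn[OF simple h', of x0 Q S])
      fix x y assume xy: "x < n" "y < n"
      then have "x = x0 \<or> x \<in> S \<or> x \<in> Q" "y = x0 \<or> y \<in> S \<or> y \<in> Q" using part(1) x0 by auto
      then show "F x y \<longleftrightarrow> x \<noteq> y \<and> (x = x0 \<or> y = x0 \<or> x \<in> Q \<and> y \<in> Q)"
        using Fx0[of x y] xy SQ[of x y] QS[of x y] Q[of x y] 2 s0 part(4) irrefl by auto
    qed (use part x0 2 in \<open>auto simp: q_def a_def\<close>)
  qed
qed

end

theorem theorem3p3:
  fixes h n m :: nat and F :: "nat \<Rightarrow> nat \<Rightarrow> bool"
  assumes "3 \<le> h" and "h \<le> n - 1"
    and "simple_graph m F" and "connected_graph m F"
    and "D_spectrum m F = D_spectrum n (Khn h n)"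
  shows "graph_iso m F n (Khn h n)"
proof -
  have m: "m = n" using assms(5) by (rule D_spectrum_eqD)
  interpret Khn_cospectral n h F
    using assms(1-4) D_spectrum_eqD(2)[OF assms(5)] unfolding m by unfold_locales
  show ?thesis unfolding m by (rule graph_iso)
qed

end
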